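(* There is a universal constant $C>0$ such that the following holds. Let $\varepsilon\in(0,1)$, let $\eta=(1+\varepsilon)\sqrt2/2$, and let $\Gamma=A^\eta$ or $\Gamma=O^\eta$, where $$A^\eta=\{(\eta\theta\cos 2\pi\theta,\eta\theta\sin 2\pi\theta):\theta\geq 0\},\qquad O^\eta=\{(x,y)\in\mathbb{R}^2: x^2+y^2=\eta^2k^2 \text{ for some } k\in\{1,2,3,\dots\}\}.$$ Then for every $W>0$, $$A(\Gamma,\mathcal{F}(W))\leq C(\varepsilon W)^{-1/2}\bigl(\ln^2(\varepsilon W)+1\bigr).$$
   Context: The Fourier transform is $\hat f(\xi)=\int e^{-2\pi i\xi\cdot x}f(x)\,dx$; functions in $L^2([-1/2,1/2]^2)$ are complex-valued and are extended by zero to $\mathbb{R}^2$ when taking Fourier transforms. For a planar open set $U$ and $f\in L^1(U)$, the variation is $$\operatorname{var}_U(f)=\sup\Bigl\{\Bigl|\int_U f\,\operatorname{div}h\Bigr|: h\in C^1_c(U,\mathbb{C}^2),\ \|h\|_\infty\leq 1\Bigr\}.$$ For $f\in L^2([-1/2,1/2]^2)$, $\operatorname{var}(f)$ denotes $\operatorname{var}_U(f)$ with $U=(-1/2,1/2)^2$. For $W>0$, $$\mathcal{F}(W)=\{f\in L^2([-1/2,1/2]^2):\operatorname{var}(f)\leq W\}.$$ With $\mu_\Gamma$ the restriction of the one-dimensional Hausdorff measure $\mathcal{H}^1$ to $\Gamma$, the stability margin is $$A(\Gamma,\mathcal{F}(W))=\inf\{\|\hat f\|_{L^2(\mu_\Gamma)}: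 f\in\mathcal{F}(W),\ \|f\|_2=1\}.$$ *)

theory Defs
  imports "HOL-Analysis.Analysis"
begin

type_synonym plane = "real \<times> real"

text \<open>
  One-dimensional Hausdorff measure.  The covering sets are required to be bounded because
  \<^const>\<open>diameter\<close> is a real number and carries no information for unbounded sets.
  No normalising factor is needed in dimension one: this is arc length on rectifiable curves.
\<close>

definition hausdorff1_size :: "real \<Rightarrow> 'a::metric_space set \<Rightarrow> ennreal" where
  "hausdorff1_size \<delta> A =
     (INF U \<in> {U :: nat \<Rightarrow> 'a set. A \<subseteq> (\<Union>i. U i) \<and> (\<forall>i. bounded (U i) \<and> diameter (U i) \<le> \<delta>)}.
        \<Sum>i. ennreal (diameter (U i)))"

definition hausdorff1_outer :: "'a::metric_space set \<Rightarrow> ennreal" where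
  "hausdorff1_outer A = (SUP \<delta>\<in>{0<..}. hausdorff1_size \<delta> A)"

text \<open>
  The outer measure above is a metric outer measure, hence countably additive on the Borel sets,
  so \<^const>\<open>measure_of\<close> agrees with it there.
\<close>

definition hausdorff1 :: "'a::metric_space measure" where
  "hausdorff1 = measure_of UNIV (sets borel) hausdorff1_outer"

text \<open>The measure on the whole plane that sends E to the length of the intersection of E
  with \<open>\<Gamma>\<close> (for Borel \<open>\<Gamma>\<close>).\<close>

definition curve_measure :: "plane set \<Rightarrow> plane measure" where
  "curve_measure \<Gamma> = density hausdorff1 (indicator \<Gamma>)"

definition l2_norm :: "'a measure \<Rightarrow> ('a \<Rightarrow> complex) \<Rightarrow> ennreal" where
  "l2_norm M f =
     (let I = (\<integral>\<^sup>+ x. ennreal ((cmod (f x))\<^sup>2) \<partial>M)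
      in if I = \<infinity> then \<infinity> else ennreal (sqrt (enn2real I)))"

definition L2 :: "'a measure \<Rightarrow> ('a \<Rightarrow> complex) set" where
  "L2 M = {f \<in> borel_measurable M. l2_norm M f < \<infinity>}"

definition zero_extension :: "'a set \<Rightarrow> ('a \<Rightarrow> complex) \<Rightarrow> 'a \<Rightarrow> complex" where
  "zero_extension S f = (\<lambda>x. if x \<in> S then f x else 0)"

definition fourier :: "(plane \<Rightarrow> complex) \<Rightarrow> plane \<Rightarrow> complex" where
  "fourier f \<xi> =
     (LINT x|lebesgue. exp (- (2 * of_real pi * \<i> * of_real (\<xi> \<bullet> x))) * f x)"

text \<open>
  Vector fields of class \<open>C\<^sup>1\<close> with compact support in the open set U.  They are total functions,
  but only their values on U matter.
\<close>

definition C1_compact_support :: "plane set \<Rightarrow> (plane \<Rightarrow> complex \<times> complex) set" where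
  "C1_compact_support U =
     {h. (\<exists>h' :: plane \<Rightarrow> plane \<Rightarrow>\<^sub>L (complex \<times> complex).
            (\<forall>x\<in>U. (h has_derivative blinfun_apply (h' x)) (at x)) \<and> continuous_on U h') \<and>
         compact (closure {x\<in>U. h x \<noteq> 0}) \<and> closure {x\<in>U. h x \<noteq> 0} \<subseteq> U}"

definition divg :: "(plane \<Rightarrow> complex \<times> complex) \<Rightarrow> plane \<Rightarrow> complex" where
  "divg h x = fst (frechet_derivative h (at x) (1, 0)) + snd (frechet_derivative h (at x) (0, 1))"

text \<open>The norm on \<^typ>\<open>complex \<times> complex\<close> is the Hermitian norm.\<close>

definition variation :: "plane set \<Rightarrow> (plane \<Rightarrow> complex) \<Rightarrow> ennreal" where
  "variation U f =
     (SUP h \<in> {h \<in> C1_compact_support U. \<forall>x\<in>U. norm (h x) \<le> 1}.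
        ennreal (cmod (LINT x|lebesgue_on U. f x * divg h x)))"

definition unit_square :: "plane set" where
  "unit_square = {-1/2..1/2} \<times> {-1/2..1/2}"

definition open_unit_square :: "plane set" where
  "open_unit_square = {-1/2<..<1/2} \<times> {-1/2<..<1/2}"

definition BV_class :: "real \<Rightarrow> (plane \<Rightarrow> complex) set" where
  "BV_class W = {f \<in> L2 (lebesgue_on unit_square). variation open_unit_square f \<le> ennreal W}"

definition stability_margin :: "plane set \<Rightarrow> (plane \<Rightarrow> complex) set \<Rightarrow> ennreal" where
  "stability_margin \<Gamma> F =
     (INF f \<in> {f \<in> F. l2_norm (lebesgue_on unit_square) f = 1}.
        l2_norm (curve_measure \<Gamma>) (fourier (zero_extension unit_square f)))"

definition spiral :: "real \<Rightarrow> plane set" where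
  "spiral \<eta> = {(\<eta> * \<theta> * cos (2 * pi * \<theta>), \<eta> * \<theta> * sin (2 * pi * \<theta>)) | \<theta>. \<theta> \<ge> 0}"

definition concentric_circles :: "real \<Rightarrow> plane set" where
  "concentric_circles \<eta> = {(x, y). \<exists>k::nat. k \<ge> 1 \<and> x\<^sup>2 + y\<^sup>2 = \<eta>\<^sup>2 * (real k)\<^sup>2}"

end

(* Near its intersection with the diagonal at distance R = sqrt 2 * rho from the origin, Gamma is
   almost a family of parallel lines of spacing eta orthogonal to the diagonal, with deviation O((1 + s^2) / R)
   at distance s.  As eta exceeds sqrt 2 / 2, the square contains two points (a, a) and (-a, -a) at distance
   1 / eta, and each of them has room for a box of half-width delta = eps / 4.  The difference of two equal
   bumps on these boxes, modulated to the frequency (rho, rho) and with the right relative phase, has a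
   Fourier transform that vanishes on all those lines.  The elementary bound |1 - e^(ix)|^2 <= 2 |x| turns
   the deviation into an L2 norm on Gamma of order (delta^2 rho)^(-1/2), provided that Gamma has bounded
   length in each unit square, so that integrals over Gamma reduce to lattice sums.  The variation is of order
   rho * delta + 1, which allows rho of order W / eps as soon as eps * W is large.  If eps * W is bounded, the
   constant function 1, of variation 0, suffices. *)
theory Submission
  imports Defs
begin

section \<open>Upper bounds for Hausdorff measure\<close>

text \<open>The bound |1 - e^(ix)|^2 \<le> 2 |x| is preferred to the sharper x^2 because of decay.
  Put s1 = x - \<rho>, s2 = y - \<rho>, D1 = 1 + (\<delta> s1)^2 and D2 = 1 + (\<delta> s2)^2. The
  squared envelope of the packets decays like 1 / (D1 D2)^2, whereas the deviation of the curve from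
  the lines is of order at most D1 D2 / (\<delta>^2 \<rho>). Squaring the deviation would use up
  both powers of D1 D2 and leave no decay for the lattice sum. The linear bound uses up one power
  and keeps the summable weight 1 / (D1 D2). It also makes the comparison with lines usable on the
  whole curve: far from (\<rho>, \<rho>) the deviation bound is weak, but the envelope absorbs it,
  so the curve need not be cut off. Summing the weight over unit cells costs \<delta>^(-2). With
  \<delta> of order \<epsilon> and \<rho> of order W / \<epsilon>, the squared norm is of order 1 /
  (\<delta>^2 \<rho>), that is 1 / (\<epsilon> W), and no logarithm arises.\<close>

lemma hausdorff1_size_le_finite_cover:
  fixes V :: "'i \<Rightarrow> 'a::metric_space set" and d \<delta> :: real
  assumes fin: "finite I" and cov: "A \<subseteq> (\<Union>i\<in>I. V i)"
    and V: "\<And>i. i \<in> I \<Longrightarrow> bounded (V i)" "\<And>i. i \<in> I \<Longrightarrow> diameter (V i) \<le> d"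
    and d: "0 \<le> d" "d \<le> \<delta>"
  shows "hausdorff1_size \<delta> A \<le> ennreal (card I * d)"
proof -
  obtain e where e: "bij_betw e {..<card I} I"
    using fin ex_bij_betw_nat_finite atLeast0LessThan by metis
  \<comment> \<open>Covers in \<open>hausdorff1_size\<close> are sequences; the empty sets used as
    padding have diameter 0 and add nothing to the sum.\<close>
  define U where "U = (\<lambda>n. if n < card I then V (e n) else {})"
  have mem: "e n \<in> I" if "n < card I" for n
    using e that by (auto simp: bij_betw_def)
  have bd: "bounded (U n) \<and> diameter (U n) \<le> d" for n
    using V mem d by (auto simp: U_def)
  have "A \<subseteq> (\<Union>n. U n)"
  proof
    fix x assume "x \<in> A"
    then obtain i where i: "i \<in> I" "x \<in> V i" using cov by auto
    then obtain n where "n < card I" "e n = i"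
      using e by (metis bij_betw_def imageE lessThan_iff)
    with i show "x \<in> (\<Union>n. U n)" by (auto simp: U_def intro!: exI[of _ n])
  qed
  with bd d have "U \<in> {U. A \<subseteq> (\<Union>i. U i) \<and> (\<forall>i. bounded (U i) \<and> diameter (U i) \<le> \<delta>)}"
    by (auto intro: order_trans)
  then have "hausdorff1_size \<delta> A \<le> (\<Sum>n. ennreal (diameter (U n)))"
    unfolding hausdorff1_size_def by (rule INF_lower)
  also have "\<dots> = (\<Sum>n<card I. ennreal (diameter (U n)))"
    by (rule suminf_finite) (auto simp: U_def)
  also have "\<dots> \<le> (\<Sum>n<card I. ennreal d)"
    using bd by (intro sum_mono ennreal_leI) auto
  also have "\<dots> = ennreal (card I * d)"
    using d by (simp add: ennreal_mult'' ennreal_of_nat_eq_real_of_nat)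
  finally show ?thesis .
qed

text \<open>
  If the outer measure were not countably additive, \<^const>\<open>measure_of\<close> would return the zero
  measure; hence upper bounds need no Caratheodory argument.
\<close>

lemma emeasure_hausdorff1_le: "emeasure hausdorff1 A \<le> hausdorff1_outer A"
  unfolding hausdorff1_def emeasure_measure_of_conv by simp

lemma sets_hausdorff1 [measurable_cong, simp]: "sets hausdorff1 = sets borel"
  using sets.sigma_sets_eq[of borel] by (simp add: hausdorff1_def sets_measure_of_conv)

lemma sets_curve_measure [measurable_cong, simp]: "sets (curve_measure \<Gamma>) = sets borel"
  by (simp add: curve_measure_def)

lemma emeasure_curve_measure_le:
  assumes "\<Gamma> \<in> sets borel" "B \<in> sets borel"
  shows "emeasure (curve_measure \<Gamma>) B \<le> hausdorff1_outer (\<Gamma> \<inter> B)"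
  using assms emeasure_hausdorff1_le[of "\<Gamma> \<inter> B"]
  by (simp add: curve_measure_def emeasure_restricted)

lemma AE_curve_measure:
  assumes "\<Gamma> \<in> sets borel"
  shows "AE x in curve_measure \<Gamma>. x \<in> \<Gamma>"
  unfolding curve_measure_def using assms
  by (subst AE_density) (auto simp: indicator_def)

section \<open>Spirals and circles as unions of turns\<close>

text \<open>1 - cos (2 pi t) is 2 sin^2 (pi t). On [0, 2] the cubic Taylor bound gives sin x \<ge> x
  - x^3 / 6 \<ge> x / 3, and pi > 3 turns this into |sin (pi t)| \<ge> |t|.\<close>

lemma one_minus_cos_ge:
  fixes t :: real
  assumes "\<bar>t\<bar> \<le> 1 / 2"
  shows "2 * t\<^sup>2 \<le> 1 - cos (2 * pi * t)"
proof -
  define x where "x = pi * \<bar>t\<bar>"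
  have x: "0 \<le> x" "x \<le> 2"
    using assms pi_less_4 mult_mono[of pi 4 "\<bar>t\<bar>" "1/2"] by (auto simp: x_def)
  have "\<bar>sin x - x\<bar> \<le> x ^ 3 / 6"
    using Maclaurin_sin_bound[of x 3] x
    by (simp add: sin_coeff_def numeral_eq_Suc fact_numeral)
  moreover have "x ^ 3 \<le> 4 * x"
    using x mult_mono[of x 2 x 2] mult_right_mono[of "x * x" 4 x] by (simp add: power3_eq_cube)
  ultimately have "x / 3 \<le> sin x" by linarith
  moreover have "\<bar>t\<bar> \<le> x / 3"
    using pi_gt3 mult_right_mono[of 3 pi "\<bar>t\<bar>"] by (auto simp: x_def)
  ultimately have "\<bar>t\<bar> \<le> sin x" by linarith
  then have "t\<^sup>2 \<le> (sin x)\<^sup>2" by (metis abs_ge_zero power2_abs power_mono)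
  also have "(sin x)\<^sup>2 = (sin (pi * t))\<^sup>2"
    by (auto simp: x_def abs_if)
  finally show ?thesis using cos_double_sin[of "pi * t"] by (simp add: algebra_simps)
qed

lemma one_minus_cos_le: "1 - cos x \<le> x\<^sup>2 / 2" for x :: real
proof -
  have "1 - cos x = 2 * (sin (x/2))\<^sup>2" using cos_double_sin[of "x/2"] by simp
  also have "(sin (x/2))\<^sup>2 \<le> (x/2)\<^sup>2"
    using abs_sin_x_le_abs_x[of "x/2"] by (subst (asm) abs_le_square_iff)
  finally show ?thesis by (simp add: power2_eq_square)
qed

text \<open>Angles are counted in full revolutions, so that one revolution changes the radius of the
  spiral by exactly \<eta>.\<close>

definition polar :: "real \<Rightarrow> real \<Rightarrow> plane" where
  "polar r \<theta> = (r * cos (2 * pi * \<theta>), r * sin (2 * pi * \<theta>))"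


text \<open>Law of cosines, arranged as a radial and an angular summand. Both are nonnegative for r,
  r' \<ge> 0, so a bound on the distance controls each of them separately.\<close>

lemma dist_polar:
  "(dist (polar r \<theta>) (polar r' \<theta>'))\<^sup>2 = (r - r')\<^sup>2 + 2 * r * r' * (1 - cos (2 * pi * (\<theta> - \<theta>')))"
proof -
  have "(r * c - r' * c')\<^sup>2 + (r * s - r' * s')\<^sup>2 = (r - r')\<^sup>2 + 2 * r * r' * (1 - (c * c' + s * s'))"
    if "s\<^sup>2 + c\<^sup>2 = 1" "s'\<^sup>2 + c'\<^sup>2 = 1" for c s c' s' :: real
  proof -
    have "(r * c - r' * c')\<^sup>2 + (r * s - r' * s')\<^sup>2
       = r\<^sup>2 * (s\<^sup>2 + c\<^sup>2) + r'\<^sup>2 * (s'\<^sup>2 + c'\<^sup>2) - 2 * r * r' * (c * c' + s * s')"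
      by (simp add: power2_eq_square algebra_simps)
    then show ?thesis unfolding that by (simp add: power2_eq_square algebra_simps)
  qed
  from this[OF sin_cos_squared_add sin_cos_squared_add, of "2 * pi * \<theta>" "2 * pi * \<theta>'"]
  have "(r * cos (2 * pi * \<theta>) - r' * cos (2 * pi * \<theta>'))\<^sup>2 + (r * sin (2 * pi * \<theta>) - r' * sin (2 * pi * \<theta>'))\<^sup>2
      = (r - r')\<^sup>2 + 2 * r * r' * (1 - cos (2 * pi * (\<theta> - \<theta>')))"
    by (simp add: right_diff_distrib cos_diff)
  then show ?thesis
    unfolding polar_def dist_Pair_Pair dist_real_def by (metis power2_abs real_sqrt_pow2 sum_power2_ge_zero)
qed

text \<open>
  The spiral is the case \<open>\<mu> = 1\<close> and the concentric circles lie in the case \<open>\<mu> = 0\<close>; the k-th turn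
  can be parametrised by \<open>\<theta>\<close> in a unit interval around any prescribed phase.
\<close>

definition turns :: "real \<Rightarrow> real \<Rightarrow> plane set" where
  "turns \<eta> \<mu> = {polar r \<theta> | r \<theta>. 0 \<le> r \<and> (\<exists>k::int. r = \<eta> * (k + \<mu> * \<theta>))}"

text \<open>Used with \<phi> the phase of a reference point: points of the curve near it then have a
  small relative angle t.\<close>

lemma turns_phase:
  assumes "\<xi> \<in> turns \<eta> \<mu>" "\<mu> = 0 \<or> \<mu> = 1"
  obtains r t :: real and k :: int where "\<bar>t\<bar> \<le> 1 / 2" "0 \<le> r" "r = \<eta> * (k + \<mu> * (\<phi> + t))" "\<xi> = polar r (\<phi> + t)"
proof -
  obtain r \<theta> :: real and k :: int where *: "\<xi> = polar r \<theta>" "0 \<le> r" "r = \<eta> * (k + \<mu> * \<theta>)"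
    using assms(1) by (auto simp: turns_def)
  define j where "j = round (\<theta> - \<phi>)"
  define t where "t = \<theta> - \<phi> - j"
  \<comment> \<open>Removing j revolutions lowers the radius of the spiral by \<eta> j, which the
    integer k makes up for; on circles the radius does not depend on the angle.\<close>
  define k' :: int where "k' = k + (if \<mu> = 1 then j else 0)"
  have \<theta>: "\<phi> + t = \<theta> - j" by (simp add: t_def)
  have t: "\<bar>t\<bar> \<le> 1 / 2"
    using of_int_round_abs_le[of "\<theta> - \<phi>"] by (simp add: t_def j_def abs_minus_commute)
  have r: "r = \<eta> * (k' + \<mu> * (\<phi> + t))"
    using *(3) assms(2) by (auto simp: k'_def \<theta>)
  have "cos (2 * pi * (\<theta> - j)) = cos (2 * pi * \<theta>)" "sin (2 * pi * (\<theta> - j)) = sin (2 * pi * \<theta>)"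
    by (simp_all add: right_diff_distrib cos_diff sin_diff cos_int_2pin sin_int_2pin)
  then have "\<xi> = polar r (\<phi> + t)"
    by (simp add: polar_def \<theta> *(1))
  with t * r that show ?thesis by blast
qed

lemma spiral_subset_turns:
  assumes "0 \<le> \<eta>" shows "spiral \<eta> \<subseteq> turns \<eta> 1"
proof
  fix \<xi> assume "\<xi> \<in> spiral \<eta>"
  then obtain \<theta> where "\<theta> \<ge> 0" "\<xi> = polar (\<eta> * \<theta>) \<theta>"
    by (auto simp: spiral_def polar_def)
  then show "\<xi> \<in> turns \<eta> 1" using assms
    unfolding turns_def
    by (intro CollectI exI[of _ "\<eta> * \<theta>"] exI[of _ "\<theta>"] conjI exI[of _ "0::int"]) auto
qed

lemma concentric_circles_subset_turns:
  assumes "0 \<le> \<eta>" shows "concentric_circles \<eta> \<subseteq> turns \<eta> 0"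
proof
  fix \<xi> assume "\<xi> \<in> concentric_circles \<eta>"
  then obtain x y and k :: nat where xy: "\<xi> = (x, y)" "x\<^sup>2 + y\<^sup>2 = \<eta>\<^sup>2 * (real k)\<^sup>2"
    by (auto simp: concentric_circles_def)
  define r where "r = \<eta> * k"
  have r: "r\<^sup>2 = x\<^sup>2 + y\<^sup>2" "r \<ge> 0" using xy assms by (simp_all add: r_def power_mult_distrib)
  obtain t where "x = r * cos t" "y = r * sin t"
  proof (cases "r = 0")
    case True
    then show ?thesis using r that[of 0] by (simp add: sum_power2_eq_zero_iff)
  next
    case False
    have "(x / r)\<^sup>2 + (y / r)\<^sup>2 = 1"
      using r(1)[symmetric] False by (simp add: power_divide flip: add_divide_distrib)
    then obtain t where "x / r = cos t" "y / r = sin t" using sincos_total_2pi by metis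
    then show ?thesis using that[of t] False by (simp add: field_simps)
  qed
  then have "\<xi> = polar r (t / (2 * pi))" by (simp add: polar_def xy)
  then show "\<xi> \<in> turns \<eta> 0" using r(2)
    by (auto simp: turns_def r_def intro!: exI[of _ "int k"])
qed

lemma closed_circle: "closed {(x, y). x\<^sup>2 + y\<^sup>2 = (c::real)}"
proof -
  have "closed {p::plane. (fst p)\<^sup>2 + (snd p)\<^sup>2 = c}"
    by (intro closed_Collect_eq continuous_intros)
  moreover have "{(x, y). x\<^sup>2 + y\<^sup>2 = c} = {p. (fst p)\<^sup>2 + (snd p)\<^sup>2 = c}" by auto
  ultimately show ?thesis by simp
qed

lemma concentric_circles_borel: "concentric_circles \<eta> \<in> sets borel"
proof -
  have "concentric_circles \<eta> = (\<Union>k\<in>{1..}. {(x, y). x\<^sup>2 + y\<^sup>2 = \<eta>\<^sup>2 * (real k)\<^sup>2})"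
    by (auto simp: concentric_circles_def)
  then show ?thesis using closed_circle by (auto intro!: sets.countable_UN borel_closed)
qed

lemma spiral_borel: "spiral \<eta> \<in> sets borel"
proof -
  have "spiral \<eta> = (\<Union>n::nat. (\<lambda>\<theta>. polar (\<eta> * \<theta>) \<theta>) ` {0..real n})"
  proof -
    have "\<exists>n::nat. \<theta> \<in> {0..real n}" if "0 \<le> \<theta>" for \<theta>
      using that real_arch_simple[of \<theta>] by auto
    then show ?thesis by (fastforce simp: spiral_def polar_def image_iff)
  qed
  moreover have "compact ((\<lambda>\<theta>. polar (\<eta> * \<theta>) \<theta>) ` {0..real n})" for n
    unfolding polar_def by (intro compact_continuous_image continuous_intros) auto
  ultimately show ?thesis
    by (metis (no_types, lifting) borel_compact sets.countable_UN image_subsetI)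
qed

section \<open>Length of the turns in sets of diameter at most 2\<close>

text \<open>Along one turn a change of t moves the radius at speed at most \<eta> \<le> 2 and the
  direction at speed at most 2 pi R \<le> 8 R; the two summands of \<open>dist_polar\<close> combine
  these.\<close>

lemma polar_segment_diameter:
  assumes "0 \<le> \<eta>" "\<eta> \<le> 2" "\<mu> = 0 \<or> \<mu> = 1" "0 \<le> R"
    and r: "r = \<eta> * (k + \<mu> * (\<phi> + t))" "0 \<le> r" "r \<le> R"
    and r': "r' = \<eta> * (k + \<mu> * (\<phi> + t'))" "0 \<le> r'" "r' \<le> R"
  shows "dist (polar r (\<phi> + t)) (polar r' (\<phi> + t')) \<le> (2 + 8 * R) * \<bar>t - t'\<bar>"
proof -
  have "\<bar>r - r'\<bar> = \<eta> * \<mu> * \<bar>t - t'\<bar>"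
    using assms(1,3) by (auto simp: r(1) r'(1) abs_mult simp flip: right_diff_distrib)
  also have "\<dots> \<le> 2 * \<bar>t - t'\<bar>" using assms(1-3) by (intro mult_right_mono) auto
  finally have 1: "\<bar>r - r'\<bar> \<le> 2 * \<bar>t - t'\<bar>" .
  have "2 * r * r' * (1 - cos (2 * pi * (t - t'))) \<le> 2 * r * r' * ((2 * pi * (t - t'))\<^sup>2 / 2)"
    using r(2) r'(2) by (intro mult_left_mono one_minus_cos_le) auto
  also have "\<dots> = (r * r') * (2 * pi * \<bar>t - t'\<bar>)\<^sup>2" by (simp add: power2_eq_square)
  also have "\<dots> \<le> (R * R) * (8 * \<bar>t - t'\<bar>)\<^sup>2"
  proof (rule mult_mono)
    show "r * r' \<le> R * R" using r(2,3) r'(2,3) by (simp add: mult_mono)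
    have "2 * pi * \<bar>t - t'\<bar> \<le> 8 * \<bar>t - t'\<bar>" using pi_less_4 by (simp add: mult_right_mono)
    then show "(2 * pi * \<bar>t - t'\<bar>)\<^sup>2 \<le> (8 * \<bar>t - t'\<bar>)\<^sup>2" by (rule power_mono) simp
  qed (use assms(4) in simp_all)
  also have "\<dots> = (8 * R * \<bar>t - t'\<bar>)\<^sup>2" by (simp add: power2_eq_square)
  finally have 2: "2 * r * r' * (1 - cos (2 * pi * (t - t'))) \<le> (8 * R * \<bar>t - t'\<bar>)\<^sup>2" .
  have "(dist (polar r (\<phi> + t)) (polar r' (\<phi> + t')))\<^sup>2 \<le> (2 * \<bar>t - t'\<bar>)\<^sup>2 + (8 * R * \<bar>t - t'\<bar>)\<^sup>2"
    unfolding dist_polar using 2 power_mono[OF 1, of 2] by simp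
  also have "\<dots> \<le> (2 * \<bar>t - t'\<bar> + 8 * R * \<bar>t - t'\<bar>)\<^sup>2"
    using assms(4) by (simp add: power2_sum)
  also have "2 * \<bar>t - t'\<bar> + 8 * R * \<bar>t - t'\<bar> = (2 + 8 * R) * \<bar>t - t'\<bar>"
    by (rule distrib_right[symmetric])
  finally show ?thesis
    by (rule power2_le_imp_le) (use assms(4) in simp)
qed

text \<open>Around a reference point of radius r0, S meets at most ten turns, each in relative
  angles of size at most \<tau>, which is proportional to 1 / (r0 + 1). The Lipschitz constant 2 + 8
  (r0 + 2) \<le> 18 (r0 + 1) cancels this, so every turn contributes length at most 18 (r0 + 1) * 2
  \<tau> = 90, independently of the distance to the origin. Cutting each turn into n equal parameter
  pieces gives covers of arbitrarily small mesh with the same total 900.\<close>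

lemma hausdorff1_turns_le:
  assumes \<eta>: "sqrt 2 / 2 \<le> \<eta>" "\<eta> \<le> 2" and \<mu>: "\<mu> = 0 \<or> \<mu> = 1"
    and S: "S \<subseteq> turns \<eta> \<mu>" "\<And>x y. x \<in> S \<Longrightarrow> y \<in> S \<Longrightarrow> dist x y \<le> 2"
  shows "hausdorff1_outer S \<le> 900"
proof (cases "S = {}")
  case True
  have "hausdorff1_size \<delta> S \<le> 900" if "0 < \<delta>" for \<delta>
    using hausdorff1_size_le_finite_cover[of "{}::nat set" S "\<lambda>_. {}" 0 \<delta>] that True
    by simp
  then show ?thesis unfolding hausdorff1_outer_def by (intro SUP_least) auto
next
  case False
  then obtain \<xi>0 where \<xi>0: "\<xi>0 \<in> S" by auto
  with S(1) obtain r0 \<phi> where r0: "0 \<le> r0" "\<xi>0 = polar r0 \<phi>" by (auto simp: turns_def)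
  have \<eta>0: "7/10 \<le> \<eta>" using \<eta>(1) real_le_rsqrt[of "7/5" 2] by (simp add: power2_eq_square)
  \<comment> \<open>If r0 \<ge> 4, then r \<ge> r0 / 2 and the angular summand gives r0 |t| \<le> 2,
    so that (r0 + 1) |t| \<le> 2 + 1/2. If r0 < 4, then |t| \<le> 1/2 alone gives (r0 + 1) |t| \<le>
    5/2.\<close>
  define \<tau> where "\<tau> = 5 / 2 / (r0 + 1)"
  have \<tau>: "0 < \<tau>" using r0 by (simp add: \<tau>_def)
  \<comment> \<open>Since |r - r0| \<le> 2, \<eta> \<ge> 7/10 and |t| \<le> 1/2, the index k is
    within 2 / (7/10) + 1/2 < 4 of r0 / \<eta> - \<mu> \<phi>. Rounding that number down leaves
    these ten integers.\<close>
  define K where "K = {\<lfloor>r0 / \<eta> - \<mu> * \<phi>\<rfloor> - 4 .. \<lfloor>r0 / \<eta> - \<mu> * \<phi>\<rfloor> + 5}"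
  have "card K = 10" by (simp add: K_def)
  have mem: "\<exists>r t. \<exists>k\<in>K. \<bar>t\<bar> \<le> \<tau> \<and> 0 \<le> r \<and> r \<le> r0 + 2 \<and> r = \<eta> * (k + \<mu> * (\<phi> + t)) \<and> \<xi> = polar r (\<phi> + t)"
    if \<xi>: "\<xi> \<in> S" for \<xi>
  proof -
    obtain r t :: real and k :: int where *: "\<bar>t\<bar> \<le> 1 / 2" "0 \<le> r" "r = \<eta> * (k + \<mu> * (\<phi> + t))" "\<xi> = polar r (\<phi> + t)"
      using turns_phase[OF subsetD[OF S(1) \<xi>] \<mu>, of \<phi>] .
    have "(dist \<xi> \<xi>0)\<^sup>2 \<le> 2\<^sup>2" using S(2)[OF \<xi> \<xi>0] by (intro power_mono) auto
    define q where "q = 2 * r * r0 * (1 - cos (2 * pi * t))"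
    have d: "(r - r0)\<^sup>2 + q \<le> 4"
      using \<open>(dist \<xi> \<xi>0)\<^sup>2 \<le> 2\<^sup>2\<close> by (simp add: *(4) r0(2) dist_polar q_def)
    have "0 \<le> q" unfolding q_def using r0(1) *(1,2) by (intro mult_nonneg_nonneg) auto
    with d have "(r - r0)\<^sup>2 \<le> 4" by linarith
    then have rr: "\<bar>r - r0\<bar> \<le> 2" using abs_le_square_iff[of "r - r0" 2] by simp
    have "2 * r * r0 * (2 * t\<^sup>2) \<le> q"
      unfolding q_def using r0(1) *(1,2) by (intro mult_left_mono one_minus_cos_ge) auto
    moreover have "q \<le> 4" using d zero_le_power2[of "r - r0"] by linarith
    ultimately have rrt: "r * r0 * t\<^sup>2 \<le> 1" by simp
    have "\<bar>t\<bar> * (r0 + 1) \<le> 5 / 2"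
    proof (cases "r0 \<ge> 4")
      case True
      then have "r0 / 2 \<le> r" using rr by linarith
      then have "(r0 / 2) * (r0 * t\<^sup>2) \<le> r * (r0 * t\<^sup>2)" using r0 by (intro mult_right_mono) auto
      with rrt have "(r0 * \<bar>t\<bar>)\<^sup>2 \<le> 2" by (simp add: power2_eq_square algebra_simps)
      also have "(2::real) \<le> 2\<^sup>2" by simp
      finally have "r0 * \<bar>t\<bar> \<le> 2" by (rule power2_le_imp_le) simp
      then show ?thesis using *(1) by (simp add: algebra_simps)
    next
      case False
      have "\<bar>t\<bar> * (r0 + 1) \<le> 1 / 2 * (r0 + 1)" using *(1) r0(1) by (intro mult_right_mono) auto
      then show ?thesis using False by simp
    qed
    then have t: "\<bar>t\<bar> \<le> \<tau>" using r0 by (simp add: \<tau>_def field_simps)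
    have "k - (r0 / \<eta> - \<mu> * \<phi>) = (r - r0) / \<eta> - \<mu> * t"
      using \<eta>0 by (simp add: *(3) field_simps)
    also have "\<bar>\<dots>\<bar> \<le> \<bar>(r - r0) / \<eta>\<bar> + \<bar>\<mu> * t\<bar>" by (rule abs_triangle_ineq4)
    also have "\<bar>(r - r0) / \<eta>\<bar> = \<bar>r - r0\<bar> / \<eta>" using \<eta>0 by simp
    also have "\<bar>\<mu> * t\<bar> \<le> 1 / 2" using \<mu> *(1) by auto
    also have "\<bar>r - r0\<bar> / \<eta> \<le> 2 / (7/10)"
      using rr \<eta>0 by (intro frac_le) auto
    finally have "\<bar>k - (r0 / \<eta> - \<mu> * \<phi>)\<bar> \<le> 4" by simp
    then have "k \<in> K" unfolding K_def atLeastAtMost_iff by linarith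
    moreover have "r \<le> r0 + 2" using rr by linarith
    ultimately show ?thesis using t *(2-4) by blast
  qed
  have "hausdorff1_size \<delta> S \<le> 900" if \<delta>: "0 < \<delta>" for \<delta>
  proof -
    obtain n :: nat where n: "90 / \<delta> \<le> real n" "0 < n"
      using real_arch_simple[of "max 1 (90 / \<delta>)"] by auto
    define I where "I = K \<times> {..n-1}"
    define V where "V = (\<lambda>(k, i). {polar r (\<phi> + t) | r t. 0 \<le> r \<and> r \<le> r0 + 2 \<and> r = \<eta> * (real_of_int k + \<mu> * (\<phi> + t))
       \<and> t \<in> {- \<tau> + 2 * \<tau> / n * real i .. - \<tau> + 2 * \<tau> / n * (real i + 1)}})"
    have dist: "dist x y \<le> 90 / n" if "x \<in> V i" "y \<in> V i" for x y i
    proof -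
      obtain k j where i: "i = (k, j)" by (cases i)
      obtain r t where x: "x = polar r (\<phi> + t)" "0 \<le> r" "r \<le> r0 + 2" "r = \<eta> * (real_of_int k + \<mu> * (\<phi> + t))"
        "t \<in> {- \<tau> + 2 * \<tau> / n * real j .. - \<tau> + 2 * \<tau> / n * (real j + 1)}"
        using \<open>x \<in> V i\<close> by (auto simp: V_def i)
      obtain r' t' where y: "y = polar r' (\<phi> + t')" "0 \<le> r'" "r' \<le> r0 + 2" "r' = \<eta> * (real_of_int k + \<mu> * (\<phi> + t'))"
        "t' \<in> {- \<tau> + 2 * \<tau> / n * real j .. - \<tau> + 2 * \<tau> / n * (real j + 1)}"
        using \<open>y \<in> V i\<close> by (auto simp: V_def i)
      have "dist x y \<le> (2 + 8 * (r0 + 2)) * \<bar>t - t'\<bar>"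
        unfolding x(1) y(1) using \<eta>0 \<eta>(2) r0(1)
        by (intro polar_segment_diameter[OF _ _ \<mu> _ x(4,2,3) y(4,2,3)]) simp_all
      also have "\<dots> \<le> (18 * (r0 + 1)) * (2 * \<tau> / n)"
      proof (rule mult_mono)
        show "\<bar>t - t'\<bar> \<le> 2 * \<tau> / n"
          using x(5) y(5) by (simp add: distrib_left) linarith
      qed (use r0 in auto)
      also have "\<dots> = (36 * ((r0 + 1) * \<tau>)) / n" by simp
      also have "(r0 + 1) * \<tau> = 5 / 2" using r0(1) by (simp add: \<tau>_def field_simps)
      finally show ?thesis by simp
    qed
    have "hausdorff1_size \<delta> S \<le> ennreal (card I * (90 / n))"
    proof (rule hausdorff1_size_le_finite_cover[where V = V])
      show "finite I" by (simp add: I_def K_def)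
      show "S \<subseteq> (\<Union>i\<in>I. V i)"
      proof
        fix \<xi> assume "\<xi> \<in> S"
        from mem[OF this] obtain r t k where *: "k \<in> K" "\<bar>t\<bar> \<le> \<tau>" "0 \<le> r" "r \<le> r0 + 2"
          "r = \<eta> * (real_of_int k + \<mu> * (\<phi> + t))" "\<xi> = polar r (\<phi> + t)" by blast
        define s where "s = (t + \<tau>) * n / (2 * \<tau>)"
        have s: "0 \<le> s" "s \<le> n" "t = - \<tau> + 2 * \<tau> / n * s"
        proof -
          have t: "0 \<le> t + \<tau>" "t + \<tau> \<le> 2 * \<tau>" using *(2) by linarith+
          then show "0 \<le> s" using \<tau> by (simp add: s_def)
          have "(t + \<tau>) * n \<le> 2 * \<tau> * n" using t by (intro mult_right_mono) auto
          then show "s \<le> n" using \<tau> by (simp add: s_def divide_le_eq mult_ac)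
          show "t = - \<tau> + 2 * \<tau> / n * s" using \<tau> n(2) by (simp add: s_def)
        qed
        \<comment> \<open>The right endpoint s = n would get the index n, which does not exist; the
          minimum assigns it to the last piece.\<close>
        define j where "j = min (nat \<lfloor>s\<rfloor>) (n - 1)"
        have j: "real j \<le> s" "s \<le> real j + 1" "j \<le> n - 1"
        proof -
          have f: "real (nat \<lfloor>s\<rfloor>) \<le> s" "s \<le> real (nat \<lfloor>s\<rfloor>) + 1" using s(1) by linarith+
          show "real j \<le> s" using f(1) by (simp add: j_def)
          show "s \<le> real j + 1"
            using f(2) s(2) n(2) by (cases "nat \<lfloor>s\<rfloor> \<le> n - 1") (simp_all add: j_def min_def of_nat_diff)
        qed (simp add: j_def)
        have "2 * \<tau> / n * real j \<le> 2 * \<tau> / n * s" "2 * \<tau> / n * s \<le> 2 * \<tau> / n * (real j + 1)"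
          using j \<tau> by (intro mult_left_mono; simp)+
        then have "t \<in> {- \<tau> + 2 * \<tau> / n * real j .. - \<tau> + 2 * \<tau> / n * (real j + 1)}"
          using s(3) by simp
        then have "\<xi> \<in> V (k, j)"
          unfolding V_def using *(3-6) by blast
        then show "\<xi> \<in> (\<Union>i\<in>I. V i)" using *(1) j(3) by (auto simp: I_def)
      qed
      show "bounded (V i)" for i
      proof (cases "V i = {}")
        case False
        then obtain x where "x \<in> V i" by blast
        then show ?thesis unfolding bounded_def using dist by blast
      qed simp
      show "diameter (V i) \<le> 90 / n" for i
        by (rule diameter_le) (simp_all add: dist flip: dist_norm)
      show "90 / n \<le> \<delta>" using n \<delta> by (simp add: field_simps)
    qed simp
    also have "card I * (90 / n) = 900" using n \<open>card K = 10\<close> by (simp add: I_def card_cartesian_product)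
    finally show ?thesis by simp
  qed
  then show ?thesis unfolding hausdorff1_outer_def by (intro SUP_least) auto
qed

text \<open>The signs of x - \<rho> and y - \<rho> split the set into at most four unit squares,
  each of diameter at most 2 and hence of length at most 900 on the curve.\<close>

lemma emeasure_turns_cell_le:
  assumes \<eta>: "sqrt 2 / 2 \<le> \<eta>" "\<eta> \<le> 2" and \<mu>: "\<mu> = 0 \<or> \<mu> = 1"
    and \<Gamma>: "\<Gamma> \<in> sets borel" "\<Gamma> \<subseteq> turns \<eta> \<mu>"
  shows "emeasure (curve_measure \<Gamma>) {(x, y). m \<le> \<bar>x - \<rho>\<bar> \<and> \<bar>x - \<rho>\<bar> \<le> m + 1 \<and> n \<le> \<bar>y - \<rho>\<bar> \<and> \<bar>y - \<rho>\<bar> \<le> n + 1} \<le> 3600"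
    (is "emeasure _ ?Q \<le> _")
proof -
  define B where "B = (\<lambda>(p::real, q::real). cbox (p, q) (p + 1, q + 1))"
  define c where "c = {\<rho> + m, \<rho> - m - 1} \<times> {\<rho> + n, \<rho> - n - 1}"
  have B: "emeasure (curve_measure \<Gamma>) (B i) \<le> 900" for i
  proof -
    obtain p q where i: "i = (p, q)" by (cases i)
    have "dist x y \<le> 2" if "x \<in> B i" "y \<in> B i" for x y
    proof -
      have "dist x y \<le> dist (fst x) (fst y) + dist (snd x) (snd y)"
        by (cases x; cases y) (auto simp: dist_Pair_Pair intro: sqrt_sum_squares_le_sum)
      also have "\<dots> \<le> 1 + 1"
        using that by (intro add_mono; cases x; cases y) (auto simp: B_def i dist_real_def)
      finally show ?thesis by simp
    qed
    then have "hausdorff1_outer (\<Gamma> \<inter> B i) \<le> 900"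
      using \<Gamma>(2) by (intro hausdorff1_turns_le[OF \<eta> \<mu>]) auto
    with emeasure_curve_measure_le[OF \<Gamma>(1), of "B i"] show ?thesis
      by (auto simp: B_def i intro: order_trans)
  qed
  have "?Q \<subseteq> (\<Union>i\<in>c. B i)"
    by (auto simp: c_def B_def abs_if split: if_splits)
  then have "emeasure (curve_measure \<Gamma>) ?Q \<le> emeasure (curve_measure \<Gamma>) (\<Union>i\<in>c. B i)"
    by (rule emeasure_mono) (auto simp: B_def c_def)
  also have "\<dots> \<le> (\<Sum>i\<in>c. emeasure (curve_measure \<Gamma>) (B i))"
    by (rule emeasure_subadditive_finite) (auto simp: B_def c_def)
  also have "\<dots> \<le> (\<Sum>i\<in>c. 900)" using B by (intro sum_mono)
  also have "\<dots> = of_nat (card c) * 900" by simp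
  also have "\<dots> \<le> of_nat 4 * 900"
  proof (intro mult_right_mono of_nat_mono)
    have "card c \<le> 2 * 2"
      unfolding c_def card_cartesian_product by (intro mult_mono) (auto simp: card_insert_if)
    then show "card c \<le> 4" by simp
  qed auto
  finally show ?thesis by simp
qed

section \<open>Integrals over the curve and sums over unit cells\<close>

text \<open>Multiplied by \<delta>, the term of index n + 1 is at most the increment of arctan from
  \<delta> n to \<delta> (n + 1). The increments telescope to less than pi / 2 \<le> 2, and the term
  of index 0 adds \<delta> \<le> 1.\<close>

lemma suminf_inverse_quadratic_le:
  fixes \<delta> :: real
  assumes "0 < \<delta>" "\<delta> \<le> 1"
  shows "(\<Sum>n. ennreal (1 / (1 + (\<delta> * real n)\<^sup>2))) \<le> ennreal (3 / \<delta>)"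
proof (rule suminf_le_const)
  fix n
  have step: "\<delta> * (1 / (1 + (\<delta> * (real n + 1))\<^sup>2)) \<le> arctan (\<delta> * (real n + 1)) - arctan (\<delta> * real n)" for n
  proof -
    have "\<delta> * real n < \<delta> * (real n + 1)" using assms by simp
    from MVT2[OF this, of arctan "\<lambda>x. inverse (1 + x\<^sup>2)"] DERIV_arctan
    obtain z where z: "\<delta> * real n < z" "z < \<delta> * (real n + 1)"
      "arctan (\<delta> * (real n + 1)) - arctan (\<delta> * real n) = \<delta> * inverse (1 + z\<^sup>2)"
      by (auto simp: algebra_simps)
    have "0 \<le> z" using z(1) assms by (smt (verit) mult_nonneg_nonneg of_nat_0_le_iff)
    then have "inverse (1 + (\<delta> * (real n + 1))\<^sup>2) \<le> inverse (1 + z\<^sup>2)"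
      using z(2) by (intro le_imp_inverse_le add_left_mono power_mono) (auto simp: add_pos_nonneg)
    then show ?thesis using z(3) assms by (simp add: divide_inverse)
  qed
  have "\<delta> * (\<Sum>i<n. 1 / (1 + (\<delta> * real i)\<^sup>2)) \<le> \<delta> + arctan (\<delta> * real n)"
  proof (cases n)
    case (Suc k)
    have "\<delta> * (\<Sum>i<n. 1 / (1 + (\<delta> * real i)\<^sup>2)) = \<delta> + (\<Sum>i<k. \<delta> * (1 / (1 + (\<delta> * (real i + 1))\<^sup>2)))"
      unfolding Suc sum.lessThan_Suc_shift by (simp add: distrib_left sum_distrib_left add.commute)
    also have "\<dots> \<le> \<delta> + (\<Sum>i<k. arctan (\<delta> * (real i + 1)) - arctan (\<delta> * real i))"
      using step by (intro add_left_mono sum_mono)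
    also have "(\<Sum>i<k. arctan (\<delta> * (real i + 1)) - arctan (\<delta> * real i)) = arctan (\<delta> * k)"
      using sum_lessThan_telescope[of "\<lambda>i. arctan (\<delta> * real i)" k] by (simp add: add.commute)
    also have "\<dots> \<le> arctan (\<delta> * n)" using Suc assms by (simp add: arctan_le_iff)
    finally show ?thesis by simp
  qed (use assms in auto)
  also have "\<dots> \<le> 1 + 2" using assms arctan_ubound[of "\<delta> * n"] pi_less_4 by simp
  finally have "(\<Sum>i<n. 1 / (1 + (\<delta> * real i)\<^sup>2)) \<le> 3 / \<delta>"
    using assms by (simp add: pos_le_divide_eq mult.commute)
  then show "(\<Sum>i<n. ennreal (1 / (1 + (\<delta> * real i)\<^sup>2))) \<le> ennreal (3 / \<delta>)"
    by (subst sum_ennreal) (auto intro!: ennreal_leI add_nonneg_nonneg)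
qed auto

text \<open>On a cell the weight is largest at the corner nearest to (\<rho>, \<rho>), so the
  integral is dominated by a product of two one-dimensional sums, and 3600 * 3 * 3 = 32400. The
  cells overlap along their edges, which is harmless for an upper bound. The hypothesis controls F
  on the curve only, hence the comparison almost everywhere.\<close>

lemma nn_integral_curve_measure_le:
  assumes \<eta>: "sqrt 2 / 2 \<le> \<eta>" "\<eta> \<le> 2" and \<mu>: "\<mu> = 0 \<or> \<mu> = 1"
    and \<Gamma>: "\<Gamma> \<in> sets borel" "\<Gamma> \<subseteq> turns \<eta> \<mu>"
    and \<delta>: "0 < \<delta>" "\<delta> \<le> 1" and M: "0 \<le> M"
    and F: "\<And>x y. (x, y) \<in> \<Gamma> \<Longrightarrow> F (x, y) \<le> M / ((1 + (\<delta> * (x - \<rho>))\<^sup>2) * (1 + (\<delta> * (y - \<rho>))\<^sup>2))"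
  shows "(\<integral>\<^sup>+ \<xi>. ennreal (F \<xi>) \<partial>curve_measure \<Gamma>) \<le> ennreal (32400 * M / \<delta>\<^sup>2)"
proof -
  define Q where "Q = (\<lambda>m n. {(x, y). real m \<le> \<bar>x - \<rho>\<bar> \<and> \<bar>x - \<rho>\<bar> \<le> real m + 1 \<and> real n \<le> \<bar>y - \<rho>\<bar> \<and> \<bar>y - \<rho>\<bar> \<le> real n + 1})"
  define w where "w = (\<lambda>n. 1 / (1 + (\<delta> * real n)\<^sup>2))"
  have w: "0 \<le> w n" for n by (simp add: w_def add_nonneg_nonneg)
  define c where "c = (\<lambda>n. ennreal (w n))"
  have Q: "Q m n \<in> sets borel" for m n
  proof -
    have "closed {p. real m \<le> \<bar>fst p - \<rho>\<bar> \<and> \<bar>fst p - \<rho>\<bar> \<le> real m + 1 \<and> real n \<le> \<bar>snd p - \<rho>\<bar> \<and> \<bar>snd p - \<rho>\<bar> \<le> real n + 1}"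
      by (intro closed_Collect_conj closed_Collect_le continuous_intros)
    moreover have "Q m n = {p. real m \<le> \<bar>fst p - \<rho>\<bar> \<and> \<bar>fst p - \<rho>\<bar> \<le> real m + 1 \<and> real n \<le> \<bar>snd p - \<rho>\<bar> \<and> \<bar>snd p - \<rho>\<bar> \<le> real n + 1}"
      by (auto simp: Q_def)
    ultimately show ?thesis by simp
  qed
  have term_le: "f k \<le> (\<Sum>n. f n)" for f :: "nat \<Rightarrow> ennreal" and k
    using sum_le_suminf[of f "{k}"] by simp
  have EQ: "emeasure (curve_measure \<Gamma>) (Q m n) \<le> 3600" for m n
    unfolding Q_def by (rule emeasure_turns_cell_le[OF \<eta> \<mu> \<Gamma>])
  have "ennreal (F \<xi>) \<le> (\<Sum>m. \<Sum>n. ennreal M * c m * c n * indicator (Q m n) \<xi>)" if "\<xi> \<in> \<Gamma>" for \<xi>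
  proof -
    obtain x y where \<xi>: "\<xi> = (x, y)" by (cases \<xi>)
    define m n where "m = nat \<lfloor>\<bar>x - \<rho>\<bar>\<rfloor>" and "n = nat \<lfloor>\<bar>y - \<rho>\<bar>\<rfloor>"
    have mn: "real m \<le> \<bar>x - \<rho>\<bar>" "\<bar>x - \<rho>\<bar> \<le> real m + 1" "real n \<le> \<bar>y - \<rho>\<bar>" "\<bar>y - \<rho>\<bar> \<le> real n + 1"
      unfolding m_def n_def by linarith+
    have mono: "1 / (1 + (\<delta> * s)\<^sup>2) \<le> 1 / (1 + (\<delta> * real k)\<^sup>2)" if "real k \<le> \<bar>s\<bar>" for k s
    proof -
      have "(\<delta> * real k)\<^sup>2 \<le> (\<delta> * s)\<^sup>2"
        using that \<delta> by (subst abs_le_square_iff[symmetric]) (simp add: abs_mult)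
      then show ?thesis by (intro divide_left_mono mult_pos_pos add_pos_nonneg) auto
    qed
    have "F \<xi> \<le> M / ((1 + (\<delta> * (x - \<rho>))\<^sup>2) * (1 + (\<delta> * (y - \<rho>))\<^sup>2))"
      using F that \<xi> by simp
    also have "\<dots> = M * ((1 / (1 + (\<delta> * (x - \<rho>))\<^sup>2)) * (1 / (1 + (\<delta> * (y - \<rho>))\<^sup>2)))" by simp
    also have "\<dots> \<le> M * (w m * w n)"
      unfolding w_def using M mn by (intro mult_left_mono mult_mono mono) (auto intro: add_nonneg_nonneg)
    finally have "ennreal (F \<xi>) \<le> ennreal (M * (w m * w n))"
      by (rule ennreal_leI)
    also have "\<dots> = ennreal M * (c m * c n)"
      using M w by (simp add: c_def ennreal_mult)
    finally have "ennreal (F \<xi>) \<le> ennreal M * c m * c n" by (simp only: mult.assoc)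
    also have "\<dots> = ennreal M * c m * c n * indicator (Q m n) \<xi>"
      using mn by (simp add: Q_def \<xi>)
    also have "\<dots> \<le> (\<Sum>n. ennreal M * c m * c n * indicator (Q m n) \<xi>)"
      by (rule term_le)
    also have "\<dots> \<le> (\<Sum>m. \<Sum>n. ennreal M * c m * c n * indicator (Q m n) \<xi>)"
      by (rule term_le)
    finally show ?thesis .
  qed
  then have "(\<integral>\<^sup>+ \<xi>. ennreal (F \<xi>) \<partial>curve_measure \<Gamma>)
      \<le> (\<integral>\<^sup>+ \<xi>. (\<Sum>m. \<Sum>n. ennreal M * c m * c n * indicator (Q m n) \<xi>) \<partial>curve_measure \<Gamma>)"
    using AE_curve_measure[OF \<Gamma>(1)] by (intro nn_integral_mono_AE) auto
  also have "\<dots> = (\<Sum>m. \<Sum>n. ennreal M * c m * c n * emeasure (curve_measure \<Gamma>) (Q m n))"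
    using Q by (simp add: nn_integral_suminf nn_integral_cmult_indicator)
  also have "\<dots> \<le> (\<Sum>m. \<Sum>n. ennreal M * c m * c n * 3600)"
    by (intro suminf_le mult_left_mono EQ) auto
  also have "\<dots> = ennreal M * (\<Sum>m. c m) * (\<Sum>n. c n) * 3600"
    by simp
  also have "\<dots> \<le> ennreal M * ennreal (3 / \<delta>) * ennreal (3 / \<delta>) * ennreal 3600"
    using suminf_inverse_quadratic_le[OF \<delta>] unfolding c_def w_def
    by (intro mult_mono) auto
  also have "\<dots> = ennreal (32400 * M / \<delta>\<^sup>2)"
    using M \<delta> by (simp add: power2_eq_square ennreal_mult[symmetric] del: ennreal_numeral)
  finally show ?thesis .
qed

section \<open>Fourier transforms\<close>

text \<open>
  Near the point \<open>(\<rho>, \<rho>)\<close> the turns are close to the lines \<open>(x + y) / (sqrt 2 * \<eta>) = \<mu> / 8 + k\<close>.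
\<close>

lemma turns_phase_near_integer:
  assumes \<eta>: "sqrt 2 / 2 \<le> \<eta>" and \<mu>: "\<mu> = 0 \<or> \<mu> = 1" and \<rho>: "0 < \<rho>"
    and xy: "(x, y) \<in> turns \<eta> \<mu>"
  obtains k :: int where
    "\<bar>(x + y) / (sqrt 2 * \<eta>) - \<mu> / 8 - k\<bar> \<le> 2 * (1 + (x - \<rho>)\<^sup>2 + (y - \<rho>)\<^sup>2) / (sqrt 2 * \<rho>)"
proof -
  \<comment> \<open>The centre (\<rho>, \<rho>) is \<open>polar R (1 / 8)\<close>: one eighth of a
    revolution is the direction of the diagonal.\<close>
  define R where "R = sqrt 2 * \<rho>"
  have R: "0 < R" using \<rho> by (simp add: R_def)
  have \<eta>0: "7/10 \<le> \<eta>" using \<eta>(1) real_le_rsqrt[of "7/5" 2] by (simp add: power2_eq_square)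
  obtain r t :: real and k :: int where *: "\<bar>t\<bar> \<le> 1 / 2" "0 \<le> r" "r = \<eta> * (k + \<mu> * (1 / 8 + t))"
    "(x, y) = polar r (1 / 8 + t)"
    using turns_phase[OF xy \<mu>, of "1 / 8"] .
  have 45: "2 * pi * (1 / 8 + t) = pi / 4 + 2 * pi * t" by (simp add: algebra_simps)
  have s2: "sqrt 2 / 2 + sqrt 2 / 2 = sqrt 2" by simp
  have "cos (2 * pi * (1 / 8 + t)) + sin (2 * pi * (1 / 8 + t)) = sqrt 2 * cos (2 * pi * t)"
    unfolding 45 cos_add sin_add by (simp add: cos_45 sin_45)
  moreover have "x + y = r * (cos (2 * pi * (1 / 8 + t)) + sin (2 * pi * (1 / 8 + t)))"
    using *(4) by (simp add: polar_def distrib_left)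
  ultimately have sum: "x + y = r * (sqrt 2 * cos (2 * pi * t))" by simp
  have "polar R (1 / 8) = (\<rho>, \<rho>)"
    by (simp add: polar_def R_def cos_45 sin_45)
  then have "(dist (x, y) (\<rho>, \<rho>))\<^sup>2 = (r - R)\<^sup>2 + 2 * r * R * (1 - cos (2 * pi * t))"
    unfolding *(4) using dist_polar[of r "1/8 + t" R "1/8"] by simp
  then have d: "(x - \<rho>)\<^sup>2 + (y - \<rho>)\<^sup>2 = (r - R)\<^sup>2 + 2 * r * R * (1 - cos (2 * pi * t))"
    by (simp add: dist_Pair_Pair dist_real_def)
  define D where "D = (x - \<rho>)\<^sup>2 + (y - \<rho>)\<^sup>2"
  have D0: "0 \<le> D" by (simp add: D_def)
  have "R * (r * (1 - cos (2 * pi * t))) \<le> D / 2"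
    using d zero_le_power2[of "r - R"] unfolding D_def by simp
  then have 1: "r * (1 - cos (2 * pi * t)) \<le> D / 2 / R" using R by (simp add: pos_le_divide_eq mult.commute)
  \<comment> \<open>The square of R |t| never exceeds D: for r \<ge> R / 2 the angular part of D
    suffices, and for smaller r the radial part is at least (R / 2)^2 while |t| \<le> 1/2. Arguing
    by contradiction supplies R |t| > 1, so that R |t| is at most its square.\<close>
  have "R * \<bar>t\<bar> \<le> 1 + D"
  proof (rule ccontr)
    assume n: "\<not> ?thesis"
    have "(R * \<bar>t\<bar>)\<^sup>2 \<le> D"
    proof (cases "R / 2 \<le> r")
      case True
      have "(R / 2) * (2 * t\<^sup>2) \<le> r * (1 - cos (2 * pi * t))"
        using True R *(1,2) by (intro mult_mono one_minus_cos_ge) auto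
      then have "2 * R * ((R / 2) * (2 * t\<^sup>2)) \<le> 2 * R * (r * (1 - cos (2 * pi * t)))"
        using R by (intro mult_left_mono) auto
      then have "2 * (R * \<bar>t\<bar>)\<^sup>2 \<le> 2 * r * R * (1 - cos (2 * pi * t))"
        by (simp add: power2_eq_square algebra_simps)
      then have "2 * (R * \<bar>t\<bar>)\<^sup>2 \<le> D"
        using d zero_le_power2[of "r - R"] unfolding D_def by linarith
      then show ?thesis using zero_le_power2[of "R * \<bar>t\<bar>"] by linarith
    next
      case False
      have "(R * \<bar>t\<bar>)\<^sup>2 \<le> (R / 2)\<^sup>2"
        using *(1) R mult_left_mono[of "\<bar>t\<bar>" "1/2" R] by (intro power_mono) auto
      also have "\<dots> \<le> (r - R)\<^sup>2"
        using False R by (subst power2_commute, intro power_mono) auto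
      also have "\<dots> \<le> D"
        unfolding D_def d using R *(2) by (simp add: mult_nonneg_nonneg)
      finally show ?thesis .
    qed
    moreover have "1 * (R * \<bar>t\<bar>) \<le> (R * \<bar>t\<bar>)\<^sup>2"
      unfolding power2_eq_square using n D0 by (intro mult_right_mono) linarith+
    ultimately show False using n by linarith
  qed
  then have 2: "\<bar>t\<bar> \<le> (1 + D) / R" using R by (simp add: pos_le_divide_eq mult.commute)
  \<comment> \<open>Two errors remain: \<mu> t, the radial drift of the spiral, and r (1 - cos (2 pi
    t)) / \<eta>, the curvature of the turn. The first is at most (1 + D) / R and the second at most
    D / R.\<close>
  have "(x + y) / (sqrt 2 * \<eta>) = r / \<eta> * cos (2 * pi * t)"
    using \<eta>0 by (simp add: sum field_simps)
  also have "r / \<eta> * cos (2 * pi * t) = r / \<eta> - (r * (1 - cos (2 * pi * t))) / \<eta>"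
    by (simp add: right_diff_distrib diff_divide_distrib)
  also have "r / \<eta> = k + \<mu> / 8 + \<mu> * t" 
  proof -
    have "r / \<eta> = k + \<mu> * (1 / 8 + t)" using \<eta>0 by (simp add: *(3))
    then show ?thesis by (simp add: distrib_left)
  qed
  finally have "(x + y) / (sqrt 2 * \<eta>) - \<mu> / 8 - k = \<mu> * t - (r * (1 - cos (2 * pi * t))) / \<eta>"
    by simp
  also have "\<bar>\<dots>\<bar> \<le> \<bar>\<mu> * t\<bar> + \<bar>(r * (1 - cos (2 * pi * t))) / \<eta>\<bar>" by (rule abs_triangle_ineq4)
  also have "\<bar>\<mu> * t\<bar> \<le> (1 + D) / R" using 2 \<mu> D0 R by auto
  also have "\<bar>(r * (1 - cos (2 * pi * t))) / \<eta>\<bar> = (r * (1 - cos (2 * pi * t))) / \<eta>"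
    using *(2) \<eta>0 by simp
  also have "\<dots> \<le> (D / 2 / R) / (1/2)"
    using 1 *(2) \<eta>0 D0 R by (intro frac_le) (auto intro: order_trans)
  also have "(1 + D) / R + (D / 2 / R) / (1/2) \<le> 2 * (1 + D) / R"
    using R D0 by (simp flip: add_divide_distrib) (intro divide_right_mono; simp)
  finally show ?thesis using that[of k] by (simp add: D_def R_def add.assoc)
qed

text \<open>The left side is 4 |sin (x / 2)|^2; one factor is bounded by |x / 2| and the other only
  by 1, which makes the bound linear.\<close>

lemma norm_one_minus_cis_le: "(cmod (1 - cis x))\<^sup>2 \<le> 2 * \<bar>x\<bar>"
proof -
  have "cmod (1 - cis x) = 2 * \<bar>sin (x / 2)\<bar>"
    using dist_exp_i_1[of x] by (simp add: cis_conv_exp norm_minus_commute)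
  then have "(cmod (1 - cis x))\<^sup>2 = 4 * (\<bar>sin (x / 2)\<bar> * \<bar>sin (x / 2)\<bar>)"
    by (simp add: power2_eq_square)
  also have "\<dots> \<le> 4 * (\<bar>x / 2\<bar> * 1)"
    by (intro mult_left_mono mult_mono abs_sin_x_le_abs_x abs_sin_le_one) auto
  finally show ?thesis by simp
qed

lemma norm_one_minus_cis_near_integer:
  assumes "\<bar>v - of_int k\<bar> \<le> d"
  shows "(cmod (1 - cis (2 * pi * v)))\<^sup>2 \<le> 4 * pi * d"
proof -
  have "cis (2 * pi * v) = cis (2 * pi * (v - of_int k)) * cis (2 * pi * of_int k)"
    unfolding cis_mult by (simp only: distrib_left[symmetric] diff_add_cancel)
  also have "cis (2 * pi * of_int k) = 1" by (simp add: cis.ctr one_complex.ctr cos_int_2pin sin_int_2pin)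
  finally have "(cmod (1 - cis (2 * pi * v)))\<^sup>2 \<le> 2 * \<bar>2 * pi * (v - of_int k)\<bar>"
    using norm_one_minus_cis_le by simp
  also have "\<dots> \<le> 4 * pi * d" using assms by (simp add: abs_mult)
  finally show ?thesis .
qed

section \<open>Fourier integrals over boxes and intervals\<close>

lemma integral_cbox_times:
  fixes u v :: "real \<Rightarrow> 'a::{real_normed_field, banach}"
  assumes "continuous_on {a..b} u" "continuous_on {c..d} v"
  shows "integral (cbox (a, c) (b, d)) (\<lambda>x. u (fst x) * v (snd x)) = integral {a..b} u * integral {c..d} v"
proof -
  have "continuous_on (cbox (a, c) (b, d)) (\<lambda>x. u (fst x) * v (snd x))"
    by (intro continuous_intros continuous_on_compose2[OF assms(1)] continuous_on_compose2[OF assms(2)]) auto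
  from integral_prod_continuous[OF this] show ?thesis by simp
qed

text \<open>Passage from the Bochner integrals in \<open>fourier\<close> and
  \<open>variation\<close> to the gauge integral, in which Fubini on boxes and the fundamental
  theorem of calculus are applied.\<close>

lemma lebesgue_integral_cbox:
  fixes g :: "'a::euclidean_space \<Rightarrow> complex"
  assumes "continuous_on (cbox a b) g"
  shows "integrable lebesgue (\<lambda>x. indicator (cbox a b) x * g x)"
    "(LINT x|lebesgue. indicator (cbox a b) x * g x) = integral (cbox a b) g"
proof -
  have i: "set_integrable lebesgue (cbox a b) g"
    using absolutely_integrable_continuous[OF assms] .
  have e: "(\<lambda>x. indicator (cbox a b) x *\<^sub>R g x) = (\<lambda>x. indicator (cbox a b) x * g x)"
    by (auto simp: indicator_def)
  show "integrable lebesgue (\<lambda>x. indicator (cbox a b) x * g x)"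
    using i by (simp add: set_integrable_def e)
  show "(LINT x|lebesgue. indicator (cbox a b) x * g x) = integral (cbox a b) g"
    using set_lebesgue_integral_eq_integral(2)[OF i] by (simp add: set_lebesgue_integral_def e)
qed

lemma norm_integral_interval_le:
  fixes g :: "real \<Rightarrow> complex"
  assumes "a \<le> b" "continuous_on {a..b} g" "\<And>t. t \<in> {a..b} \<Longrightarrow> cmod (g t) \<le> B"
  shows "cmod (integral {a..b} g) \<le> B * (b - a)"
  using integral_bound[OF assms(1,2)] assms(3) by blast

text \<open>Fourier transform of one arch of the cosine on [-\<delta>, \<delta>]. The arch vanishes
  at both ends; this yields quadratic decay and later removes the boundary terms in the variation,
  while the transform stays elementary.\<close>

definition cosine_transform :: "real \<Rightarrow> real \<Rightarrow> complex" where
  "cosine_transform \<delta> s = integral {-\<delta>..\<delta>} (\<lambda>t. cis (- 2 * pi * s * t) * complex_of_real (cos (pi / (2 * \<delta>) * t)))"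

lemma cis_has_vector_derivative:
  "((\<lambda>t. cis (c * t)) has_vector_derivative (\<i> * c * cis (c * t))) (at t within S)"
  unfolding cis_conv_exp
  by (rule has_vector_derivative_real_field[THEN has_vector_derivative_eq_rhs] derivative_eq_intros refl | simp)+

lemma cosine_transform_bound_trivial:
  assumes "0 < \<delta>"
  shows "cmod (cosine_transform \<delta> s) \<le> 2 * \<delta>"
proof -
  have "cmod (cosine_transform \<delta> s) \<le> 1 * (\<delta> - (- \<delta>))"
    unfolding cosine_transform_def
    using assms by (intro norm_integral_interval_le) (auto intro!: continuous_intros simp: norm_mult)
  then show ?thesis by simp
qed

text \<open>At the ends of the interval the cosine vanishes, so an explicit antiderivative gives
  \<kappa> (cis (-\<omega> \<delta>) + cis (\<omega> \<delta>)) / (\<kappa>^2 - \<omega>^2). The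
  hypothesis on s means |\<omega>| \<ge> 2 \<kappa>. It stays away from the removable singularity
  |\<omega>| = \<kappa> and makes the denominator at least 3/4 \<omega>^2 in modulus.\<close>

lemma cosine_transform_bound_decay:
  assumes \<delta>: "0 < \<delta>" and s: "1 \<le> 2 * \<bar>s\<bar> * \<delta>"
  shows "cmod (cosine_transform \<delta> s) \<le> 1 / (3 * pi * \<delta> * s\<^sup>2)"
proof -
  define \<kappa> where "\<kappa> = pi / (2 * \<delta>)"
  define \<omega> where "\<omega> = 2 * pi * s"
  have \<kappa>: "0 < \<kappa>" "\<kappa> * \<delta> = pi / 2" using \<delta> by (simp_all add: \<kappa>_def)
  have "2 * \<kappa> = pi / \<delta>" by (simp add: \<kappa>_def)
  also have "\<dots> \<le> \<bar>\<omega>\<bar>"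
    using s \<delta> by (simp add: \<omega>_def abs_mult pos_divide_le_eq mult_ac)
  finally have "(2 * \<kappa>)\<^sup>2 \<le> \<omega>\<^sup>2" using \<kappa> by (metis abs_le_square_iff abs_of_pos zero_less_mult_iff zero_less_numeral)
  then have \<omega>\<kappa>: "3 / 4 * \<omega>\<^sup>2 \<le> \<omega>\<^sup>2 - \<kappa>\<^sup>2" by (simp add: power_mult_distrib)
  have "s \<noteq> 0" using s by auto
  then have \<omega>0: "0 < \<omega>\<^sup>2" by (simp add: \<omega>_def)
  define G where "G = (\<lambda>t. cis ((- \<omega>) * t) * (complex_of_real (\<kappa> * sin (\<kappa> * t)) - \<i> * \<omega> * complex_of_real (cos (\<kappa> * t))) / (\<kappa>\<^sup>2 - \<omega>\<^sup>2))"
  have ne: "complex_of_real \<kappa> ^ 2 - complex_of_real \<omega> ^ 2 \<noteq> 0"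
  proof -
    have "\<kappa>\<^sup>2 \<noteq> \<omega>\<^sup>2" using \<omega>\<kappa> \<omega>0 by linarith
    then show ?thesis by (metis of_real_eq_iff of_real_power right_minus_eq)
  qed
  have G': "(G has_vector_derivative (cis ((- \<omega>) * t) * complex_of_real (cos (\<kappa> * t)))) (at t within {-\<delta>..\<delta>})" for t
  proof -
    have 1: "((\<lambda>t. complex_of_real (\<kappa> * sin (\<kappa> * t))) has_vector_derivative complex_of_real (\<kappa> * (\<kappa> * cos (\<kappa> * t)))) (at t within {-\<delta>..\<delta>})"
      by (rule has_vector_derivative_of_real) (auto intro!: derivative_eq_intros simp: has_real_derivative_iff_has_vector_derivative[symmetric])
    have 2: "((\<lambda>t. complex_of_real (cos (\<kappa> * t))) has_vector_derivative complex_of_real (- (\<kappa> * sin (\<kappa> * t)))) (at t within {-\<delta>..\<delta>})"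
      by (rule has_vector_derivative_of_real) (auto intro!: derivative_eq_intros simp: has_real_derivative_iff_has_vector_derivative[symmetric])
    let ?c = "cis ((- \<omega>) * t)" and ?s = "complex_of_real (sin (\<kappa> * t))" and ?C = "complex_of_real (cos (\<kappa> * t))"
    have "?c * (complex_of_real (\<kappa> * (\<kappa> * cos (\<kappa> * t))) - \<i> * \<omega> * complex_of_real (- (\<kappa> * sin (\<kappa> * t))))
        + \<i> * complex_of_real (- \<omega>) * ?c * (complex_of_real (\<kappa> * sin (\<kappa> * t)) - \<i> * \<omega> * ?C)
      = (?c * ?C) * (complex_of_real \<kappa> ^ 2 - complex_of_real \<omega> ^ 2)"
      by (simp add: algebra_simps power2_eq_square)
    with has_vector_derivative_divide[OF has_vector_derivative_mult[OF cis_has_vector_derivative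
        has_vector_derivative_diff[OF 1 has_vector_derivative_mult_right[OF 2]]], of "- \<omega>" "\<i> * \<omega>" "complex_of_real \<kappa> ^ 2 - complex_of_real \<omega> ^ 2"]
    show ?thesis
      using ne unfolding G_def by simp
  qed
  have "((\<lambda>t. cis ((- \<omega>) * t) * complex_of_real (cos (\<kappa> * t))) has_integral (G \<delta> - G (- \<delta>))) {-\<delta>..\<delta>}"
    using \<delta> G' by (intro fundamental_theorem_of_calculus) auto
  then have "cosine_transform \<delta> s = G \<delta> - G (- \<delta>)"
    unfolding cosine_transform_def by (intro integral_unique) (simp add: \<omega>_def \<kappa>_def)
  also have "\<dots> = complex_of_real \<kappa> * (cis (- \<omega> * \<delta>) + cis (\<omega> * \<delta>)) / (\<kappa>\<^sup>2 - \<omega>\<^sup>2)"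
    by (simp add: G_def \<kappa>(2) mult.commute[of _ "complex_of_real \<kappa>"] flip: add_divide_distrib distrib_left)
  also have "cmod \<dots> \<le> \<kappa> * 2 / (\<omega>\<^sup>2 - \<kappa>\<^sup>2)"
  proof -
    have n: "\<bar>\<kappa>\<^sup>2 - \<omega>\<^sup>2\<bar> = \<omega>\<^sup>2 - \<kappa>\<^sup>2" using \<omega>\<kappa> \<omega>0 by linarith
    have "cmod (cis (- \<omega> * \<delta>) + cis (\<omega> * \<delta>)) \<le> 2"
      using norm_triangle_ineq[of "cis (- \<omega> * \<delta>)" "cis (\<omega> * \<delta>)"] by simp
    then have "\<bar>\<kappa>\<bar> * cmod (cis (- \<omega> * \<delta>) + cis (\<omega> * \<delta>)) / (\<omega>\<^sup>2 - \<kappa>\<^sup>2) \<le> \<kappa> * 2 / (\<omega>\<^sup>2 - \<kappa>\<^sup>2)"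
      using \<kappa>(1) \<omega>\<kappa> \<omega>0 by (intro divide_right_mono mult_mono) (linarith | rule norm_ge_zero)+
    then show ?thesis by (simp only: norm_divide norm_mult norm_of_real of_real_power[symmetric] of_real_diff[symmetric] n)
  qed
  also have "\<dots> \<le> \<kappa> * 2 / (3 / 4 * \<omega>\<^sup>2)"
    using \<omega>\<kappa> \<omega>0 \<kappa>(1) by (intro divide_left_mono mult_pos_pos) linarith+
  also have "\<dots> = 1 / (3 * pi * \<delta> * s\<^sup>2)"
    using \<delta> \<open>s \<noteq> 0\<close> by (simp add: \<kappa>_def \<omega>_def power2_eq_square field_simps)
  finally show ?thesis .
qed

text \<open>A single weight for all s, in the shape that the lattice sums use; the trivial bound
  covers the frequencies around the removable singularity.\<close>

lemma cosine_transform_bound: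
  assumes \<delta>: "0 < \<delta>"
  shows "cmod (cosine_transform \<delta> s) \<le> 3 * \<delta> / (1 + (\<delta> * s)\<^sup>2)"
proof (cases "1 \<le> 2 * \<bar>s\<bar> * \<delta>")
  case True
  then have "s \<noteq> 0" by auto
  have "1\<^sup>2 \<le> (2 * \<bar>s\<bar> * \<delta>)\<^sup>2" using True by (intro power_mono) auto
  then have 1: "1 \<le> 4 * (\<delta> * s)\<^sup>2" by (simp add: power2_eq_square mult_ac)
  have "1 / (3 * pi * \<delta> * s\<^sup>2) = \<delta> / (3 * pi * (\<delta> * s)\<^sup>2)"
    using \<delta> by (simp add: power2_eq_square)
  also have "\<dots> = 3 * \<delta> / (9 * pi * (\<delta> * s)\<^sup>2)" by simp
  also have "\<dots> \<le> 3 * \<delta> / (1 + (\<delta> * s)\<^sup>2)"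
  proof (rule divide_left_mono)
    have "5 * (\<delta> * s)\<^sup>2 \<le> 9 * pi * (\<delta> * s)\<^sup>2" using pi_gt3 by (intro mult_right_mono) auto
    then show "1 + (\<delta> * s)\<^sup>2 \<le> 9 * pi * (\<delta> * s)\<^sup>2" using 1 by linarith
  qed (use \<delta> \<open>s \<noteq> 0\<close> in \<open>auto simp: add_pos_nonneg\<close>)
  finally show ?thesis using cosine_transform_bound_decay[OF \<delta> True] by linarith
next
  case False
  then have "(2 * \<bar>s\<bar> * \<delta>)\<^sup>2 \<le> 1\<^sup>2" using \<delta> by (intro power_mono) auto
  then have "1 + (\<delta> * s)\<^sup>2 \<le> 3 / 2" by (simp add: power2_eq_square mult_ac)
  then have "2 * \<delta> * (1 + (\<delta> * s)\<^sup>2) \<le> 2 * \<delta> * (3 / 2)" using \<delta> by (intro mult_left_mono) auto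
  then have "2 * \<delta> \<le> 3 * \<delta> / (1 + (\<delta> * s)\<^sup>2)"
    by (subst pos_le_divide_eq) (auto simp: add_pos_nonneg)
  then show ?thesis using cosine_transform_bound_trivial[OF \<delta>, of s] by linarith
qed

text \<open>The indicator of an interval jumps at its ends, so its transform S decays only like 1 /
  |s|; the square has summable decay nevertheless. The bound is the sum of |S|^2 \<le> 1 and s^2
  |S|^2 \<le> 1.\<close>

lemma interval_transform_bound:
  "(cmod (integral {-1/2..1/2} (\<lambda>t. cis (- 2 * pi * s * t))))\<^sup>2 \<le> 2 / (1 + s\<^sup>2)"
proof -
  define S where "S = integral {-1/2..1/2} (\<lambda>t. cis (- 2 * pi * s * t))"
  have "cmod S \<le> 1 * (1/2 - (-1/2))"
    unfolding S_def by (intro norm_integral_interval_le) (auto intro!: continuous_intros)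
  then have 1: "(cmod S)\<^sup>2 \<le> 1" by (simp add: power_le_one)
  have 2: "s\<^sup>2 * (cmod S)\<^sup>2 \<le> 1"
  proof (cases "s = 0")
    case False
    have "((\<lambda>t. cis ((- 2 * pi * s) * t)) has_integral (cis ((- 2 * pi * s) * (1/2)) / (\<i> * (- 2 * pi * s)) - cis ((- 2 * pi * s) * (-1/2)) / (\<i> * (- 2 * pi * s)))) {-1/2..1/2}"
    proof (rule fundamental_theorem_of_calculus)
      fix t
      have "((\<lambda>t. cis ((- 2 * pi * s) * t) / (\<i> * (- 2 * pi * s))) has_vector_derivative (\<i> * (- 2 * pi * s) * cis ((- 2 * pi * s) * t)) / (\<i> * (- 2 * pi * s))) (at t within {-1/2..1/2})"
        using has_vector_derivative_divide[OF cis_has_vector_derivative[of "- 2 * pi * s" t "{-1/2..1/2}"], of "\<i> * (- 2 * pi * s)"]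
        by simp
      then show "((\<lambda>t. cis ((- 2 * pi * s) * t) / (\<i> * (- 2 * pi * s))) has_vector_derivative cis ((- 2 * pi * s) * t)) (at t within {-1/2..1/2})"
        using False by simp
    qed simp
    then have "S = cis ((- 2 * pi * s) * (1/2)) / (\<i> * (- 2 * pi * s)) - cis ((- 2 * pi * s) * (-1/2)) / (\<i> * (- 2 * pi * s))"
      unfolding S_def by (intro integral_unique) simp
    also have "cmod \<dots> \<le> 1 / (2 * pi * \<bar>s\<bar>) + 1 / (2 * pi * \<bar>s\<bar>)"
      by (rule order_trans[OF norm_triangle_ineq4]) (simp add: norm_divide norm_mult)
    also have "\<dots> \<le> 1 / \<bar>s\<bar>"
      using False pi_gt3 by (simp add: field_simps)
    finally have "\<bar>s\<bar> * cmod S \<le> 1" using False by (simp add: field_simps)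
    then have "(\<bar>s\<bar> * cmod S)\<^sup>2 \<le> 1" by (simp add: power_le_one)
    then show ?thesis by (simp add: power_mult_distrib)
  qed simp
  have "(cmod S)\<^sup>2 * (1 + s\<^sup>2) \<le> 2" using 1 2 by (simp add: algebra_simps)
  then show ?thesis unfolding S_def[symmetric]
    by (subst pos_le_divide_eq) (auto simp: add_pos_nonneg)
qed

section \<open>Variation\<close>

lemma integral_partial_snd_eq_0:
  fixes F D :: "real \<times> real \<Rightarrow> complex"
  assumes "c \<le> d" and D: "continuous_on (cbox (a, c) (b, d)) D"
    and F: "\<And>x y. x \<in> {a..b} \<Longrightarrow> y \<in> {c..d} \<Longrightarrow> ((\<lambda>y. F (x, y)) has_vector_derivative D (x, y)) (at y within {c..d})"
    and 0: "\<And>x. x \<in> {a..b} \<Longrightarrow> F (x, c) = 0 \<and> F (x, d) = 0"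
  shows "integral (cbox (a, c) (b, d)) D = 0"
proof -
  have "integral {c..d} (\<lambda>y. D (x, y)) = 0" if x: "x \<in> {a..b}" for x
    using fundamental_theorem_of_calculus[OF \<open>c \<le> d\<close> F[OF x]] 0[OF x] by (simp add: integral_unique)
  then have "integral {a..b} (\<lambda>x. integral {c..d} (\<lambda>y. D (x, y))) = integral {a..b} (\<lambda>x. 0)"
    by (intro integral_cong) auto
  with integral_prod_continuous[OF D] show ?thesis by simp
qed

lemma integral_partial_fst_eq_0:
  fixes F D :: "real \<times> real \<Rightarrow> complex"
  assumes "a \<le> b" and D: "continuous_on (cbox (a, c) (b, d)) D"
    and F: "\<And>x y. x \<in> {a..b} \<Longrightarrow> y \<in> {c..d} \<Longrightarrow> ((\<lambda>x. F (x, y)) has_vector_derivative D (x, y)) (at x within {a..b})"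
    and 0: "\<And>y. y \<in> {c..d} \<Longrightarrow> F (a, y) = 0 \<and> F (b, y) = 0"
  shows "integral (cbox (a, c) (b, d)) D = 0"
proof -
  have D': "continuous_on (cbox (a, c) (b, d)) (\<lambda>(x, y). D (x, y))" using D by simp
  have "integral (cbox (a, c) (b, d)) D = integral (cbox (c, a) (d, b)) (\<lambda>(y, x). D (x, y))"
    using integral_swap_2dim[OF D'] by simp
  also have "\<dots> = 0"
    using swap_continuous[OF D'] F 0
    by (intro integral_partial_snd_eq_0[OF \<open>a \<le> b\<close>, where F = "\<lambda>(y, x). F (x, y)"]) auto
  finally show ?thesis .
qed

lemma C1_compact_support_partials:
  assumes "h \<in> C1_compact_support U"
  obtains h1 h2 where "continuous_on U h1" "continuous_on U h2"
    "\<And>x y. (x, y) \<in> U \<Longrightarrow> ((\<lambda>x. fst (h (x, y))) has_vector_derivative h1 (x, y)) (at x)"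
    "\<And>x y. (x, y) \<in> U \<Longrightarrow> ((\<lambda>y. snd (h (x, y))) has_vector_derivative h2 (x, y)) (at y)"
    "\<And>p. p \<in> U \<Longrightarrow> divg h p = h1 p + h2 p" "continuous_on U h"
proof -
  obtain h' :: "plane \<Rightarrow> plane \<Rightarrow>\<^sub>L (complex \<times> complex)" where
    h': "\<And>p. p \<in> U \<Longrightarrow> (h has_derivative blinfun_apply (h' p)) (at p)" "continuous_on U h'"
    using assms by (auto simp: C1_compact_support_def)
  define h1 where "h1 = (\<lambda>p. fst (blinfun_apply (h' p) (1, 0)))"
  define h2 where "h2 = (\<lambda>p. snd (blinfun_apply (h' p) (0, 1)))"
  show ?thesis
  proof (rule that[of h1 h2])
    show "continuous_on U h1" "continuous_on U h2"
      unfolding h1_def h2_def by (intro continuous_intros h'(2))+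
    show "continuous_on U h"
      using h'(1) by (intro continuous_at_imp_continuous_on) (auto intro: has_derivative_continuous)
    show "divg h p = h1 p + h2 p" if "p \<in> U" for p
      using frechet_derivative_at[OF h'(1)[OF that]] by (simp add: divg_def h1_def h2_def)
    fix x y assume xy: "(x, y) \<in> U"
    have "((\<lambda>x. h (x, y)) has_derivative (\<lambda>d. blinfun_apply (h' (x, y)) (d, 0))) (at x)"
      by (rule has_derivative_compose[of "\<lambda>x. (x, y)" "\<lambda>d. (d, 0)" x UNIV h "blinfun_apply (h' (x, y))", OF _ h'(1)[OF xy]])
        (auto intro!: derivative_eq_intros)
    moreover have "(\<lambda>d. blinfun_apply (h' (x, y)) (d, 0)) = (\<lambda>d. d *\<^sub>R blinfun_apply (h' (x, y)) (1, 0))"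
    proof
      show "blinfun_apply (h' (x, y)) (d, 0) = d *\<^sub>R blinfun_apply (h' (x, y)) (1, 0)" for d
        using blinfun.scaleR_right[of "h' (x, y)" d "(1, 0)"] by simp
    qed
    ultimately have "((\<lambda>x. h (x, y)) has_vector_derivative blinfun_apply (h' (x, y)) (1, 0)) (at x)"
      unfolding has_vector_derivative_def by (simp only:)
    from bounded_linear.has_vector_derivative[OF bounded_linear_fst this]
    show "((\<lambda>x. fst (h (x, y))) has_vector_derivative h1 (x, y)) (at x)" by (simp add: h1_def)
    have "((\<lambda>y. h (x, y)) has_derivative (\<lambda>d. blinfun_apply (h' (x, y)) (0, d))) (at y)"
      by (rule has_derivative_compose[of "\<lambda>y. (x, y)" "\<lambda>d. (0, d)" y UNIV h "blinfun_apply (h' (x, y))", OF _ h'(1)[OF xy]])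
        (auto intro!: derivative_eq_intros)
    moreover have "(\<lambda>d. blinfun_apply (h' (x, y)) (0, d)) = (\<lambda>d. d *\<^sub>R blinfun_apply (h' (x, y)) (0, 1))"
    proof
      show "blinfun_apply (h' (x, y)) (0, d) = d *\<^sub>R blinfun_apply (h' (x, y)) (0, 1)" for d
        using blinfun.scaleR_right[of "h' (x, y)" d "(0, 1)"] by simp
    qed
    ultimately have "((\<lambda>y. h (x, y)) has_vector_derivative blinfun_apply (h' (x, y)) (0, 1)) (at y)"
      unfolding has_vector_derivative_def by (simp only:)
    from bounded_linear.has_vector_derivative[OF bounded_linear_snd this]
    show "((\<lambda>y. snd (h (x, y))) has_vector_derivative h2 (x, y)) (at y)" by (simp add: h2_def)
  qed
qed

text \<open>The integrals of the x-derivative of g times the first component of h and of the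
  y-derivative of g times the second one vanish. The boundary condition is a disjunction in order to
  cover two situations: a packet g that vanishes on the edges of its box, and the constant g with an
  h that vanishes on the edges of a box around its support.\<close>

lemma integral_divg_by_parts:
  fixes g gx gy :: "plane \<Rightarrow> complex"
  assumes h: "h \<in> C1_compact_support U" and B: "cbox (a, c) (b, d) \<subseteq> U" "a \<le> b" "c \<le> d"
    and g: "continuous_on UNIV g" "continuous_on UNIV gx" "continuous_on UNIV gy"
      "\<And>x y. ((\<lambda>x. g (x, y)) has_vector_derivative gx (x, y)) (at x)"
      "\<And>x y. ((\<lambda>y. g (x, y)) has_vector_derivative gy (x, y)) (at y)"
    and bd: "\<And>y. y \<in> {c..d} \<Longrightarrow> (g (a, y) = 0 \<or> h (a, y) = 0) \<and> (g (b, y) = 0 \<or> h (b, y) = 0)"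
      "\<And>x. x \<in> {a..b} \<Longrightarrow> (g (x, c) = 0 \<or> h (x, c) = 0) \<and> (g (x, d) = 0 \<or> h (x, d) = 0)"
  shows "continuous_on (cbox (a, c) (b, d)) (\<lambda>p. g p * divg h p)"
    "integral (cbox (a, c) (b, d)) (\<lambda>p. g p * divg h p)
      = - integral (cbox (a, c) (b, d)) (\<lambda>p. gx p * fst (h p) + gy p * snd (h p))"
proof -
  let ?B = "cbox (a, c) (b, d)"
  obtain h1 h2 where h12: "continuous_on U h1" "continuous_on U h2"
    "\<And>x y. (x, y) \<in> U \<Longrightarrow> ((\<lambda>x. fst (h (x, y))) has_vector_derivative h1 (x, y)) (at x)"
    "\<And>x y. (x, y) \<in> U \<Longrightarrow> ((\<lambda>y. snd (h (x, y))) has_vector_derivative h2 (x, y)) (at y)"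
    "\<And>p. p \<in> U \<Longrightarrow> divg h p = h1 p + h2 p" "continuous_on U h"
    using C1_compact_support_partials[OF h] by blast
  have c [continuous_intros]: "continuous_on ?B g" "continuous_on ?B gx" "continuous_on ?B gy"
    "continuous_on ?B h1" "continuous_on ?B h2" "continuous_on ?B h"
    using g(1-3) h12(1,2,6) B(1) by (auto intro: continuous_on_subset)
  have mem: "(x, y) \<in> U" if "x \<in> {a..b}" "y \<in> {c..d}" for x y using that B(1) by auto
  have "integral ?B (\<lambda>p. g p * h1 p + gx p * fst (h p)) = 0"
  proof (rule integral_partial_fst_eq_0[OF B(2), where F = "\<lambda>p. g p * fst (h p)"])
    show "((\<lambda>x. g (x, y) * fst (h (x, y))) has_vector_derivative g (x, y) * h1 (x, y) + gx (x, y) * fst (h (x, y))) (at x within {a..b})"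
      if "x \<in> {a..b}" "y \<in> {c..d}" for x y
      using that by (intro has_vector_derivative_mult has_vector_derivative_at_within[OF g(4)]
          has_vector_derivative_at_within[OF h12(3)] mem)
    show "g (a, y) * fst (h (a, y)) = 0 \<and> g (b, y) * fst (h (b, y)) = 0" if "y \<in> {c..d}" for y
      using bd(1)[OF that] by auto
  qed (intro continuous_intros)
  moreover have "integral ?B (\<lambda>p. g p * h2 p + gy p * snd (h p)) = 0"
  proof (rule integral_partial_snd_eq_0[OF B(3), where F = "\<lambda>p. g p * snd (h p)"])
    show "((\<lambda>y. g (x, y) * snd (h (x, y))) has_vector_derivative g (x, y) * h2 (x, y) + gy (x, y) * snd (h (x, y))) (at y within {c..d})"
      if "x \<in> {a..b}" "y \<in> {c..d}" for x y
      using that by (intro has_vector_derivative_mult has_vector_derivative_at_within[OF g(5)]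
          has_vector_derivative_at_within[OF h12(4)] mem)
    show "g (x, c) * snd (h (x, c)) = 0 \<and> g (x, d) * snd (h (x, d)) = 0" if "x \<in> {a..b}" for x
      using bd(2)[OF that] by auto
  qed (intro continuous_intros)
  moreover have "integral ?B (\<lambda>p. (g p * h1 p + gx p * fst (h p)) + (g p * h2 p + gy p * snd (h p)))
     = integral ?B (\<lambda>p. g p * h1 p + gx p * fst (h p)) + integral ?B (\<lambda>p. g p * h2 p + gy p * snd (h p))"
    by (intro integral_add integrable_continuous continuous_intros)
  moreover have "integral ?B (\<lambda>p. (g p * h1 p + gx p * fst (h p)) + (g p * h2 p + gy p * snd (h p)))
     = integral ?B (\<lambda>p. g p * (h1 p + h2 p) + (gx p * fst (h p) + gy p * snd (h p)))"
    by (simp add: algebra_simps)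
  moreover have "\<dots> = integral ?B (\<lambda>p. g p * (h1 p + h2 p)) + integral ?B (\<lambda>p. gx p * fst (h p) + gy p * snd (h p))"
    by (intro integral_add integrable_continuous continuous_intros)
  moreover have dv: "g p * divg h p = g p * (h1 p + h2 p)" if "p \<in> ?B" for p
    using h12(5)[OF subsetD[OF B(1) that]] by simp
  then have "integral ?B (\<lambda>p. g p * divg h p) = integral ?B (\<lambda>p. g p * (h1 p + h2 p))"
    by (rule integral_cong)
  ultimately show "integral ?B (\<lambda>p. g p * divg h p) = - integral ?B (\<lambda>p. gx p * fst (h p) + gy p * snd (h p))"
    by (simp add: eq_neg_iff_add_eq_0)
  have "continuous_on ?B (\<lambda>p. g p * (h1 p + h2 p))" by (intro continuous_intros)
  then show "continuous_on ?B (\<lambda>p. g p * divg h p)"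
    by (subst continuous_on_cong[OF refl dv])
qed

lemma norm_integral_divg_le:
  fixes g gx gy :: "plane \<Rightarrow> complex"
  assumes h: "h \<in> C1_compact_support U" "\<And>p. p \<in> U \<Longrightarrow> norm (h p) \<le> 1"
    and B: "cbox (a, c) (b, d) \<subseteq> U" "a \<le> b" "c \<le> d"
    and g: "continuous_on UNIV g" "continuous_on UNIV gx" "continuous_on UNIV gy"
      "\<And>x y. ((\<lambda>x. g (x, y)) has_vector_derivative gx (x, y)) (at x)"
      "\<And>x y. ((\<lambda>y. g (x, y)) has_vector_derivative gy (x, y)) (at y)"
    and bd: "\<And>y. y \<in> {c..d} \<Longrightarrow> (g (a, y) = 0 \<or> h (a, y) = 0) \<and> (g (b, y) = 0 \<or> h (b, y) = 0)"
      "\<And>x. x \<in> {a..b} \<Longrightarrow> (g (x, c) = 0 \<or> h (x, c) = 0) \<and> (g (x, d) = 0 \<or> h (x, d) = 0)"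
    and K: "0 \<le> K" "\<And>p. cmod (gx p) \<le> K" "\<And>p. cmod (gy p) \<le> K"
  shows "cmod (integral (cbox (a, c) (b, d)) (\<lambda>p. g p * divg h p)) \<le> 2 * K * ((b - a) * (d - c))"
proof -
  let ?B = "cbox (a, c) (b, d)"
  have ch: "continuous_on U h"
    using C1_compact_support_partials[OF h(1)] by metis
  have ch: "continuous_on ?B h" using ch B(1) by (rule continuous_on_subset)
  have cont: "continuous_on ?B (\<lambda>p. gx p * fst (h p) + gy p * snd (h p))"
    using g(2,3) by (intro continuous_intros ch) (auto intro: continuous_on_subset)
  have "cmod (gx p * fst (h p) + gy p * snd (h p)) \<le> 2 * K" if "p \<in> ?B" for p
  proof -
    have "norm (h p) \<le> 1" using h(2) B(1) that by blast
    then have "norm (fst (h p)) \<le> 1" "norm (snd (h p)) \<le> 1"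
      using norm_fst_le[of "fst (h p)" "snd (h p)"] norm_snd_le[of "snd (h p)" "fst (h p)"] by simp_all
    then have "cmod (gx p * fst (h p)) \<le> K * 1" "cmod (gy p * snd (h p)) \<le> K * 1"
      unfolding norm_mult using K by (intro mult_mono; simp)+
    then show ?thesis using norm_triangle_ineq[of "gx p * fst (h p)" "gy p * snd (h p)"] by linarith
  qed
  then have "cmod (integral ?B (\<lambda>p. gx p * fst (h p) + gy p * snd (h p))) \<le> 2 * K * measure lborel ?B"
    using K(1) by (intro has_integral_bound[OF _ integrable_integral[OF integrable_continuous[OF cont]]]) auto
  also have "measure lborel ?B = (b - a) * (d - c)" using B by (simp add: content_Pair)
  finally show ?thesis
    using integral_divg_by_parts(2)[OF h(1) B g bd] by simp
qed

lemma open_unit_square_lebesgue: "open_unit_square \<in> sets lebesgue"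
  unfolding open_unit_square_def by (intro sets_completionI_sets) (simp add: open_Times borel_open)

lemma unit_square_eq_cbox: "unit_square = cbox (-1/2, -1/2) (1/2, 1/2)"
  by (simp add: unit_square_def cbox_Pair_eq)

lemma unit_square_lebesgue: "unit_square \<in> sets lebesgue"
  unfolding unit_square_eq_cbox by simp

lemma nn_integral_cbox:
  fixes g :: "'a::euclidean_space \<Rightarrow> real"
  assumes "continuous_on (cbox a b) g" "\<And>x. 0 \<le> g x"
  shows "(\<integral>\<^sup>+x. ennreal (g x) * indicator (cbox a b) x \<partial>lebesgue) = ennreal (integral (cbox a b) g)"
  using nn_integral_has_integral_lebesgue'[OF assms(2) integrable_integral[OF integrable_continuous[OF assms(1)]]]
  by (simp add: nn_integral_completion)

lemma l2_norm_le:
  assumes "0 \<le> B" "(\<integral>\<^sup>+x. ennreal ((cmod (f x))\<^sup>2) \<partial>M) \<le> ennreal (B\<^sup>2)"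
  shows "l2_norm M f \<le> ennreal B"
proof -
  define I where "I = (\<integral>\<^sup>+x. ennreal ((cmod (f x))\<^sup>2) \<partial>M)"
  have I: "I \<le> ennreal (B\<^sup>2)" using assms(2) by (simp add: I_def)
  then have "I \<noteq> \<infinity>" by (auto simp: top_unique)
  moreover have "enn2real I \<le> B\<^sup>2" using I by (intro enn2real_leI) auto
  then have "sqrt (enn2real I) \<le> B" using assms(1) by (intro real_le_lsqrt) auto
  ultimately show ?thesis unfolding l2_norm_def I_def[symmetric] by (simp add: Let_def ennreal_leI)
qed

lemma l2_norm_eq_1:
  assumes "(\<integral>\<^sup>+x. ennreal ((cmod (f x))\<^sup>2) \<partial>M) = 1"
  shows "l2_norm M f = 1"
  using assms by (simp add: l2_norm_def)

section \<open>Wave packets\<close>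

text \<open>The arch centred at a and modulated to frequency \<rho>, before the cut-off. It is
  smooth on the whole line; the restriction to |t - a| \<le> \<delta> is left to the domains of
  integration.\<close>

definition wave :: "real \<Rightarrow> real \<Rightarrow> real \<Rightarrow> real \<Rightarrow> complex" where
  "wave \<rho> \<kappa> a t = cis (2 * pi * \<rho> * t) * complex_of_real (cos (\<kappa> * (t - a)))"

definition wave' :: "real \<Rightarrow> real \<Rightarrow> real \<Rightarrow> real \<Rightarrow> complex" where
  "wave' \<rho> \<kappa> a t = cis (2 * pi * \<rho> * t) * complex_of_real (- (\<kappa> * sin (\<kappa> * (t - a))))
     + \<i> * complex_of_real (2 * pi * \<rho>) * cis (2 * pi * \<rho> * t) * complex_of_real (cos (\<kappa> * (t - a)))"

lemma wave_has_vector_derivative: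
  "(wave \<rho> \<kappa> a has_vector_derivative wave' \<rho> \<kappa> a t) (at t within S)"
proof -
  have "((\<lambda>t. complex_of_real (cos (\<kappa> * (t - a)))) has_vector_derivative complex_of_real (- (\<kappa> * sin (\<kappa> * (t - a))))) (at t within S)"
    by (rule has_vector_derivative_of_real) (auto intro!: derivative_eq_intros simp: has_real_derivative_iff_has_vector_derivative[symmetric])
  from has_vector_derivative_mult[OF cis_has_vector_derivative this, of "2 * pi * \<rho>"]
  show ?thesis unfolding wave_def wave'_def by simp
qed

lemma continuous_on_wave: "continuous_on S (wave \<rho> \<kappa> a)" "continuous_on S (wave' \<rho> \<kappa> a)"
  unfolding wave_def wave'_def by (intro continuous_intros)+

lemma norm_wave: "cmod (wave \<rho> \<kappa> a t) = \<bar>cos (\<kappa> * (t - a))\<bar>"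
  by (simp add: wave_def norm_mult)

lemma norm_wave'_le:
  assumes "0 \<le> \<rho>" "0 \<le> \<kappa>"
  shows "cmod (wave' \<rho> \<kappa> a t) \<le> 2 * pi * \<rho> + \<kappa>"
proof -
  have "cmod (wave' \<rho> \<kappa> a t) \<le> \<kappa> * \<bar>sin (\<kappa> * (t - a))\<bar> + 2 * pi * \<rho> * \<bar>cos (\<kappa> * (t - a))\<bar>"
    unfolding wave'_def using assms
    by (intro order_trans[OF norm_triangle_ineq]) (simp add: norm_mult abs_mult)
  also have "\<dots> \<le> \<kappa> * 1 + 2 * pi * \<rho> * 1"
    using assms by (intro add_mono mult_left_mono abs_sin_le_one abs_cos_le_one) auto
  finally show ?thesis by simp
qed

lemma wave_endpoints:
  assumes "0 < \<delta>"
  shows "wave \<rho> (pi / (2 * \<delta>)) a (a + \<delta>) = 0" "wave \<rho> (pi / (2 * \<delta>)) a (a - \<delta>) = 0"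
  using assms by (simp_all add: wave_def)

text \<open>Modulation replaces s by s - \<rho> and translation by a contributes a phase. The
  modulating factor is cis (2 pi \<rho> t), not centred at a, and therefore the phase contains s -
  \<rho> as well.\<close>

lemma wave_transform:
  "integral {a - \<delta>..a + \<delta>} (\<lambda>t. cis (- 2 * pi * s * t) * wave \<rho> (pi / (2 * \<delta>)) a t)
     = cis (- 2 * pi * (s - \<rho>) * a) * cosine_transform \<delta> (s - \<rho>)"
proof -
  let ?f = "\<lambda>t. cis (- 2 * pi * s * t) * wave \<rho> (pi / (2 * \<delta>)) a t"
  have "cis (- 2 * pi * s * (t + a)) * cis (2 * pi * \<rho> * (t + a)) = cis (- 2 * pi * (s - \<rho>) * a) * cis (- 2 * pi * (s - \<rho>) * t)" for t
    unfolding cis_mult by (rule arg_cong[of _ _ cis]) (simp add: algebra_simps)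
  then have *: "?f (t + a) = cis (- 2 * pi * (s - \<rho>) * a) * (cis (- 2 * pi * (s - \<rho>) * t) * complex_of_real (cos (pi / (2 * \<delta>) * t)))" for t
    unfolding wave_def by (simp only: mult.assoc[symmetric]) simp
  have "integral {a - \<delta>..a + \<delta>} ?f = integral {a - \<delta> - a..a + \<delta> - a} (\<lambda>t. ?f (t + a))"
    by (rule integral_shift_real_ivl[symmetric])
  also have "\<dots> = integral {-\<delta>..\<delta>} (\<lambda>t. cis (- 2 * pi * (s - \<rho>) * a) * (cis (- 2 * pi * (s - \<rho>) * t) * complex_of_real (cos (pi / (2 * \<delta>) * t))))"
    unfolding * by simp
  also have "\<dots> = cis (- 2 * pi * (s - \<rho>) * a) * cosine_transform \<delta> (s - \<rho>)"
    unfolding cosine_transform_def by (rule integral_mult_right)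
  finally show ?thesis .
qed

lemma integral_norm_wave_square:
  assumes \<delta>: "0 < \<delta>"
  shows "integral {a - \<delta>..a + \<delta>} (\<lambda>t. (cmod (wave \<rho> (pi / (2 * \<delta>)) a t))\<^sup>2) = \<delta>"
proof -
  define \<kappa> where "\<kappa> = pi / (2 * \<delta>)"
  define G where "G = (\<lambda>t. t / 2 + sin (2 * (\<kappa> * (t - a))) / (4 * \<kappa>))"
  have \<kappa>: "\<kappa> \<noteq> 0" "2 * (\<kappa> * \<delta>) = pi" using \<delta> by (simp_all add: \<kappa>_def)
  have "(G has_vector_derivative (cos (\<kappa> * (t - a)))\<^sup>2) (at t within {a - \<delta>..a + \<delta>})" for t
  proof -
    have "(G has_real_derivative 1 / 2 + cos (2 * (\<kappa> * (t - a))) * (2 * \<kappa>) / (4 * \<kappa>)) (at t within {a - \<delta>..a + \<delta>})"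
      unfolding G_def by (auto intro!: derivative_eq_intros simp: \<kappa>(1))
    moreover have "1 / 2 + cos (2 * (\<kappa> * (t - a))) * (2 * \<kappa>) / (4 * \<kappa>) = (cos (\<kappa> * (t - a)))\<^sup>2"
      using \<kappa>(1) unfolding cos_double_cos by (simp add: field_simps)
    ultimately show ?thesis by (simp add: has_real_derivative_iff_has_vector_derivative)
  qed
  then have "((\<lambda>t. (cos (\<kappa> * (t - a)))\<^sup>2) has_integral (G (a + \<delta>) - G (a - \<delta>))) {a - \<delta>..a + \<delta>}"
    using \<delta> by (intro fundamental_theorem_of_calculus) auto
  moreover have "G (a + \<delta>) - G (a - \<delta>) = \<delta>"
    using \<kappa>(2) by (simp add: G_def add_divide_distrib diff_divide_distrib)
  ultimately show ?thesis
    by (simp add: norm_wave \<kappa>_def[symmetric] integral_unique)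
qed

definition packet :: "real \<Rightarrow> real \<Rightarrow> real \<Rightarrow> plane \<Rightarrow> complex" where
  "packet \<rho> \<delta> a p = wave \<rho> (pi / (2 * \<delta>)) a (fst p) * wave \<rho> (pi / (2 * \<delta>)) a (snd p)"

abbreviation packet_box :: "real \<Rightarrow> real \<Rightarrow> plane set" where
  "packet_box \<delta> a \<equiv> cbox (a - \<delta>, a - \<delta>) (a + \<delta>, a + \<delta>)"

lemma continuous_on_packet: "continuous_on S (packet \<rho> \<delta> a)"
  unfolding packet_def
  by (intro continuous_intros continuous_on_compose2[OF continuous_on_wave(1)]) auto

lemma integral_norm_packet_square:
  assumes "0 < \<delta>"
  shows "integral (packet_box \<delta> a) (\<lambda>p. (cmod (packet \<rho> \<delta> a p))\<^sup>2) = \<delta>\<^sup>2"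
proof -
  let ?w = "\<lambda>t. (cmod (wave \<rho> (pi / (2 * \<delta>)) a t))\<^sup>2"
  have "continuous_on {a - \<delta>..a + \<delta>} ?w" by (intro continuous_intros continuous_on_wave)
  from integral_cbox_times[OF this this] show ?thesis
    using assms by (simp add: packet_def norm_mult power_mult_distrib integral_norm_wave_square power2_eq_square[of \<delta>])
qed

lemma exp_fourier_kernel:
  "exp (- (2 * of_real pi * \<i> * of_real (\<xi> \<bullet> p))) = cis (- 2 * pi * fst \<xi> * fst p) * cis (- 2 * pi * snd \<xi> * snd p)"
  for \<xi> p :: plane
proof -
  have "cis (- 2 * pi * fst \<xi> * fst p) * cis (- 2 * pi * snd \<xi> * snd p) = cis (- 2 * pi * (\<xi> \<bullet> p))"
    unfolding cis_mult by (rule arg_cong[of _ _ cis]) (simp add: inner_prod_def algebra_simps)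
  then show ?thesis by (simp add: cis_conv_exp mult_ac)
qed

lemma integral_fourier_cbox_times:
  assumes "continuous_on {a..b} u" "continuous_on {c..d} v"
  shows "integral (cbox (a, c) (b, d)) (\<lambda>p. exp (- (2 * of_real pi * \<i> * of_real (\<xi> \<bullet> p))) * (u (fst p) * v (snd p)))
    = integral {a..b} (\<lambda>t. cis (- 2 * pi * fst \<xi> * t) * u t) * integral {c..d} (\<lambda>t. cis (- 2 * pi * snd \<xi> * t) * v t)"
proof -
  have "continuous_on {a..b} (\<lambda>t. cis (- 2 * pi * fst \<xi> * t) * u t)" "continuous_on {c..d} (\<lambda>t. cis (- 2 * pi * snd \<xi> * t) * v t)"
    using assms by (auto intro!: continuous_intros)
  from integral_cbox_times[OF this] show ?thesis
    by (simp only: exp_fourier_kernel) (simp add: mult_ac)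
qed

lemma packet_transform:
  "integral (packet_box \<delta> a) (\<lambda>p. exp (- (2 * of_real pi * \<i> * of_real (\<xi> \<bullet> p))) * packet \<rho> \<delta> a p)
   = cis (- 2 * pi * (fst \<xi> + snd \<xi> - 2 * \<rho>) * a) * (cosine_transform \<delta> (fst \<xi> - \<rho>) * cosine_transform \<delta> (snd \<xi> - \<rho>))"
proof -
  have "cis (- 2 * pi * (fst \<xi> + snd \<xi> - 2 * \<rho>) * a) = cis (- 2 * pi * (fst \<xi> - \<rho>) * a) * cis (- 2 * pi * (snd \<xi> - \<rho>) * a)"
    unfolding cis_mult by (rule arg_cong[of _ _ cis]) (simp add: algebra_simps)
  then show ?thesis
    unfolding packet_def integral_fourier_cbox_times[OF continuous_on_wave(1) continuous_on_wave(1)] wave_transform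
    by (simp only: mult.assoc mult.left_commute)
qed

text \<open>The partial derivatives of a packet are at most 2 pi \<rho> + pi / (2 \<delta>) and its
  box has area 4 \<delta>^2. As the packet vanishes on the edges of the box, cutting it off creates
  no boundary term.\<close>

lemma packet_divg:
  assumes h: "h \<in> C1_compact_support U" "\<And>p. p \<in> U \<Longrightarrow> norm (h p) \<le> 1"
    and B: "packet_box \<delta> a \<subseteq> U" and "0 < \<delta>" "0 \<le> \<rho>"
  shows "continuous_on (packet_box \<delta> a) (\<lambda>p. c * packet \<rho> \<delta> a p * divg h p)"
    "cmod (integral (packet_box \<delta> a) (\<lambda>p. c * packet \<rho> \<delta> a p * divg h p))
      \<le> cmod c * (16 * pi * \<rho> * \<delta>\<^sup>2 + 4 * pi * \<delta>)"
proof -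
  define \<kappa> where "\<kappa> = pi / (2 * \<delta>)"
  have \<kappa>: "0 \<le> \<kappa>" using \<open>0 < \<delta>\<close> by (simp add: \<kappa>_def)
  let ?w = "wave \<rho> \<kappa> a" and ?w' = "wave' \<rho> \<kappa> a"
  define K where "K = cmod c * (2 * pi * \<rho> + \<kappa>)"
  have g: "c * packet \<rho> \<delta> a p = c * (?w (fst p) * ?w (snd p))" for p
    by (simp add: packet_def \<kappa>_def)
  have cont: "continuous_on UNIV (\<lambda>p. c * (?w (fst p) * ?w (snd p)))"
    "continuous_on UNIV (\<lambda>p. c * (?w' (fst p) * ?w (snd p)))"
    "continuous_on UNIV (\<lambda>p. c * (?w (fst p) * ?w' (snd p)))"
    by (intro continuous_intros continuous_on_compose2[OF continuous_on_wave(1)[of UNIV]]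
        continuous_on_compose2[OF continuous_on_wave(2)[of UNIV]] subset_UNIV)+
  have D: "((\<lambda>x. c * (?w (fst (x, y)) * ?w (snd (x, y)))) has_vector_derivative c * (?w' (fst (x, y)) * ?w (snd (x, y)))) (at x)"
    "((\<lambda>y. c * (?w (fst (x, y)) * ?w (snd (x, y)))) has_vector_derivative c * (?w (fst (x, y)) * ?w' (snd (x, y)))) (at y)" for x y
    unfolding fst_conv snd_conv
    by (intro has_vector_derivative_mult_right has_vector_derivative_mult_left wave_has_vector_derivative)+
  have w: "cmod (?w t) \<le> 1" for t by (simp add: norm_wave)
  have w': "cmod (?w' t) \<le> 2 * pi * \<rho> + \<kappa>" for t using \<kappa> \<open>0 \<le> \<rho>\<close> by (rule norm_wave'_le[rotated])
  have K: "0 \<le> K" using \<kappa> \<open>0 \<le> \<rho>\<close> by (simp add: K_def)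
  have K1: "cmod (c * (?w' (fst p) * ?w (snd p))) \<le> K" for p :: plane
    unfolding K_def norm_mult using mult_mono[OF w' w] \<kappa> \<open>0 \<le> \<rho>\<close>
    by (intro mult_left_mono) auto
  have K2: "cmod (c * (?w (fst p) * ?w' (snd p))) \<le> K" for p :: plane
    unfolding K_def norm_mult using mult_mono[OF w w'] \<kappa> \<open>0 \<le> \<rho>\<close>
    by (intro mult_left_mono) auto
  have 0: "?w (a - \<delta>) = 0" "?w (a + \<delta>) = 0" using wave_endpoints[OF \<open>0 < \<delta>\<close>] by (simp_all add: \<kappa>_def)
  have le: "a - \<delta> \<le> a + \<delta>" using \<open>0 < \<delta>\<close> by simp
  show "continuous_on (packet_box \<delta> a) (\<lambda>p. c * packet \<rho> \<delta> a p * divg h p)"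
    unfolding g by (rule integral_divg_by_parts(1)[OF h(1) B le le cont D]) (simp_all add: 0)
  have "cmod (integral (packet_box \<delta> a) (\<lambda>p. c * packet \<rho> \<delta> a p * divg h p)) \<le> 2 * K * ((a + \<delta> - (a - \<delta>)) * (a + \<delta> - (a - \<delta>)))"
    unfolding g by (rule norm_integral_divg_le[OF h B le le cont D _ _ K K1 K2]) (simp_all add: 0)
  also have "\<dots> = cmod c * (16 * pi * \<rho> * \<delta>\<^sup>2 + 4 * pi * \<delta>)"
    using \<open>0 < \<delta>\<close> by (simp add: K_def \<kappa>_def field_simps power2_eq_square)
  finally show "cmod (integral (packet_box \<delta> a) (\<lambda>p. c * packet \<rho> \<delta> a p * divg h p)) \<le> cmod c * (16 * pi * \<rho> * \<delta>\<^sup>2 + 4 * pi * \<delta>)" .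
qed

section \<open>Superposition of two packets\<close>

text \<open>Each packet has squared norm \<delta>^2 on its box, so two disjoint boxes explain the
  factor 1 / (sqrt 2 * \<delta>). The unimodular c is the relative phase.\<close>

definition two_packets :: "real \<Rightarrow> real \<Rightarrow> real \<Rightarrow> complex \<Rightarrow> plane \<Rightarrow> complex" where
  "two_packets \<rho> \<delta> a c p = indicator (packet_box \<delta> a) p * (complex_of_real (1 / (sqrt 2 * \<delta>)) * packet \<rho> \<delta> a p)
     + indicator (packet_box \<delta> (- a)) p * (- (complex_of_real (1 / (sqrt 2 * \<delta>)) * c) * packet \<rho> \<delta> (- a) p)"

lemma packet_box_subset:
  assumes "0 < \<delta>" "\<bar>a\<bar> + \<delta> < 1 / 2"
  shows "packet_box \<delta> a \<subseteq> open_unit_square" "packet_box \<delta> a \<subseteq> unit_square"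
  using assms by (auto simp: open_unit_square_def unit_square_def cbox_Pair_eq)

lemma packet_box_disjoint:
  assumes "0 < \<delta>" "\<delta> < a"
  shows "packet_box \<delta> a \<inter> packet_box \<delta> (- a) = {}"
  using assms by (auto simp: cbox_Pair_eq)

lemma two_packets_measurable: "two_packets \<rho> \<delta> a c \<in> borel_measurable (lebesgue_on S)"
proof -
  have "packet \<rho> \<delta> b \<in> borel_measurable borel" for b
    by (rule borel_measurable_continuous_onI[OF continuous_on_packet])
  then have "two_packets \<rho> \<delta> a c \<in> borel_measurable borel"
    unfolding two_packets_def by measurable
  then have "two_packets \<rho> \<delta> a c \<in> borel_measurable lebesgue"
    by (simp add: measurable_completion)
  then show ?thesis by (rule measurable_restrict_space1)
qed

lemma l2_norm_two_packets:
  assumes \<delta>: "0 < \<delta>" and a: "\<delta> < a" "a + \<delta> < 1 / 2" and c: "cmod c = 1"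
  shows "l2_norm (lebesgue_on unit_square) (two_packets \<rho> \<delta> a c) = 1"
proof (rule l2_norm_eq_1)
  let ?N = "complex_of_real (1 / (sqrt 2 * \<delta>))"
  let ?g = "\<lambda>b p. (cmod (?N * packet \<rho> \<delta> b p))\<^sup>2"
  have sub: "packet_box \<delta> a \<subseteq> unit_square" "packet_box \<delta> (- a) \<subseteq> unit_square"
    using packet_box_subset(2)[of \<delta> a] packet_box_subset(2)[of \<delta> "- a"] \<delta> a by simp_all
  have c': "cmod (- (?N * c) * z) = cmod (?N * z)" for z
    by (simp only: norm_mult norm_minus_cancel c mult_1_right)
  have eq: "ennreal ((cmod (two_packets \<rho> \<delta> a c p))\<^sup>2) * indicator unit_square p
      = ennreal (?g a p) * indicator (packet_box \<delta> a) p + ennreal (?g (- a) p) * indicator (packet_box \<delta> (- a)) p" for p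
  proof -
    consider "p \<in> packet_box \<delta> a" "p \<notin> packet_box \<delta> (- a)" | "p \<notin> packet_box \<delta> a" "p \<in> packet_box \<delta> (- a)"
      | "p \<notin> packet_box \<delta> a" "p \<notin> packet_box \<delta> (- a)"
      using packet_box_disjoint[OF \<delta> a(1)] by blast
    then show ?thesis
    proof cases
      case 1
      then show ?thesis using subsetD[OF sub(1) 1(1)] by (simp only: two_packets_def indicator_simps) simp
    next
      case 2
      have "two_packets \<rho> \<delta> a c p = - (?N * c) * packet \<rho> \<delta> (- a) p"
        using 2 by (simp only: two_packets_def indicator_simps) simp
      then have "cmod (two_packets \<rho> \<delta> a c p) = cmod (?N * packet \<rho> \<delta> (- a) p)" by (simp only: c')
      then show ?thesis using 2 subsetD[OF sub(2) 2(2)] by (simp only: indicator_simps) simp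
    next
      case 3
      then show ?thesis by (simp only: two_packets_def indicator_simps) simp
    qed
  qed
  have int: "(\<integral>\<^sup>+p. ennreal (?g b p) * indicator (packet_box \<delta> b) p \<partial>lebesgue) = ennreal (1 / 2)" for b
  proof -
    have "(\<integral>\<^sup>+p. ennreal (?g b p) * indicator (packet_box \<delta> b) p \<partial>lebesgue) = ennreal (integral (packet_box \<delta> b) (?g b))"
      by (rule nn_integral_cbox) (use \<delta> in \<open>auto intro!: continuous_intros continuous_on_packet\<close>)
    also have "integral (packet_box \<delta> b) (?g b) = integral (packet_box \<delta> b) (\<lambda>p. 1 / (2 * \<delta>\<^sup>2) * (cmod (packet \<rho> \<delta> b p))\<^sup>2)"
      by (intro integral_cong) (use \<delta> in \<open>simp add: norm_mult norm_divide power_mult_distrib power_divide\<close>)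
    also have "\<dots> = 1 / (2 * \<delta>\<^sup>2) * \<delta>\<^sup>2"
      by (simp only: integral_mult_right integral_norm_packet_square[OF \<delta>])
    also have "\<dots> = 1 / 2" using \<delta> by simp
    finally show ?thesis .
  qed
  have meas: "(\<lambda>p. ennreal (?g b p) * indicator (packet_box \<delta> b) p) \<in> borel_measurable lebesgue" for b
  proof -
    have "packet \<rho> \<delta> b \<in> borel_measurable borel"
      by (rule borel_measurable_continuous_onI[OF continuous_on_packet])
    then have "(\<lambda>p. ennreal (?g b p) * indicator (packet_box \<delta> b) p) \<in> borel_measurable borel"
      by measurable
    then show ?thesis by (simp add: measurable_completion)
  qed
  have "(\<integral>\<^sup>+p. ennreal ((cmod (two_packets \<rho> \<delta> a c p))\<^sup>2) \<partial>lebesgue_on unit_square)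
      = (\<integral>\<^sup>+p. ennreal ((cmod (two_packets \<rho> \<delta> a c p))\<^sup>2) * indicator unit_square p \<partial>lebesgue)"
    using unit_square_lebesgue by (simp add: nn_integral_restrict_space)
  also have "\<dots> = ennreal (1 / 2) + ennreal (1 / 2)"
    unfolding eq by (subst nn_integral_add[OF meas meas]) (simp only: int)
  also have "\<dots> = 1" by (subst ennreal_plus[symmetric]) auto
  finally show "(\<integral>\<^sup>+p. ennreal ((cmod (two_packets \<rho> \<delta> a c p))\<^sup>2) \<partial>lebesgue_on unit_square) = 1" .
qed

lemma variation_two_packets:
  assumes \<delta>: "0 < \<delta>" and a: "\<delta> < a" "a + \<delta> < 1 / 2" and c: "cmod c = 1" and \<rho>: "0 \<le> \<rho>"
  shows "variation open_unit_square (two_packets \<rho> \<delta> a c) \<le> ennreal (32 * pi * \<rho> * \<delta> + 8 * pi)"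
  unfolding variation_def
proof (rule SUP_least)
  fix h assume "h \<in> {h \<in> C1_compact_support open_unit_square. \<forall>x\<in>open_unit_square. norm (h x) \<le> 1}"
  then have h: "h \<in> C1_compact_support open_unit_square" "\<And>p. p \<in> open_unit_square \<Longrightarrow> norm (h p) \<le> 1" by auto
  let ?U = open_unit_square
  let ?N = "complex_of_real (1 / (sqrt 2 * \<delta>))"
  let ?K = "1 / (sqrt 2 * \<delta>) * (16 * pi * \<rho> * \<delta>\<^sup>2 + 4 * pi * \<delta>)"
  have sub: "packet_box \<delta> a \<subseteq> ?U" "packet_box \<delta> (- a) \<subseteq> ?U"
    using packet_box_subset(1)[of \<delta> a] packet_box_subset(1)[of \<delta> "- a"] \<delta> a by simp_all
  let ?g1 = "\<lambda>p. ?N * packet \<rho> \<delta> a p * divg h p"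
  let ?g2 = "\<lambda>p. - (?N * c) * packet \<rho> \<delta> (- a) p * divg h p"
  note 1 = packet_divg[OF h sub(1) \<delta> \<rho>, where c = ?N]
  note 2 = packet_divg[OF h sub(2) \<delta> \<rho>, where c = "- (?N * c)"]
  have eq: "indicator ?U p *\<^sub>R (two_packets \<rho> \<delta> a c p * divg h p)
      = indicator (packet_box \<delta> a) p * ?g1 p + indicator (packet_box \<delta> (- a)) p * ?g2 p" for p
    using sub by (cases "p \<in> ?U") (auto simp: two_packets_def indicator_def algebra_simps)
  have "(LINT x|lebesgue_on ?U. two_packets \<rho> \<delta> a c x * divg h x)
      = (LINT p|lebesgue. indicator ?U p *\<^sub>R (two_packets \<rho> \<delta> a c p * divg h p))"
    using open_unit_square_lebesgue by (simp add: integral_restrict_space)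
  also have "\<dots> = integral (packet_box \<delta> a) ?g1 + integral (packet_box \<delta> (- a)) ?g2"
    unfolding eq
    by (simp only: Bochner_Integration.integral_add[OF lebesgue_integral_cbox(1)[OF 1(1)] lebesgue_integral_cbox(1)[OF 2(1)]]
        lebesgue_integral_cbox(2)[OF 1(1)] lebesgue_integral_cbox(2)[OF 2(1)])
  finally have "cmod (LINT x|lebesgue_on ?U. two_packets \<rho> \<delta> a c x * divg h x)
      \<le> cmod (integral (packet_box \<delta> a) ?g1) + cmod (integral (packet_box \<delta> (- a)) ?g2)"
    by (simp only: norm_triangle_ineq)
  also have "\<dots> \<le> ?K + ?K"
  proof (rule add_mono)
    have N: "cmod ?N = 1 / (sqrt 2 * \<delta>)" "cmod (- (?N * c)) = 1 / (sqrt 2 * \<delta>)"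
      using \<delta> c by (simp_all add: norm_divide norm_mult)
    show "cmod (integral (packet_box \<delta> a) ?g1) \<le> ?K" using 1(2) by (simp only: N(1))
    show "cmod (integral (packet_box \<delta> (- a)) ?g2) \<le> ?K" using 2(2) by (simp only: N(2))
  qed
  \<comment> \<open>The normalisation cancels one factor \<delta>, which turns \<rho> \<delta>^2 +
    \<delta> into \<rho> \<delta> + 1.\<close>
  also have "\<dots> = (32 * pi * \<rho> * \<delta> + 8 * pi) / sqrt 2"
  proof -
    have "?K = (16 * pi * \<rho> * \<delta> + 4 * pi) * \<delta> / (sqrt 2 * \<delta>)"
      by (simp add: power2_eq_square distrib_right)
    also have "\<dots> = (16 * pi * \<rho> * \<delta> + 4 * pi) / sqrt 2" using \<delta> by simp
    finally show ?thesis by (simp flip: add_divide_distrib)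
  qed
  also have "\<dots> \<le> (32 * pi * \<rho> * \<delta> + 8 * pi) / 1"
    using \<delta> \<rho> by (intro divide_left_mono) auto
  finally show "ennreal (cmod (LINT x|lebesgue_on ?U. two_packets \<rho> \<delta> a c x * divg h x)) \<le> ennreal (32 * pi * \<rho> * \<delta> + 8 * pi)"
    by (simp add: ennreal_leI)
qed

text \<open>The two packets have the same transform up to a phase. The result is an envelope centred
  at (\<rho>, \<rho>) times an interference factor that depends on x + y only.\<close>

lemma fourier_two_packets:
  assumes \<delta>: "0 < \<delta>" and a: "\<delta> < a" "a + \<delta> < 1 / 2"
  shows "fourier (zero_extension unit_square (two_packets \<rho> \<delta> a c)) \<xi>
    = complex_of_real (1 / (sqrt 2 * \<delta>)) * (cosine_transform \<delta> (fst \<xi> - \<rho>) * cosine_transform \<delta> (snd \<xi> - \<rho>))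
      * (cis (- 2 * pi * (fst \<xi> + snd \<xi> - 2 * \<rho>) * a) - c * cis (2 * pi * (fst \<xi> + snd \<xi> - 2 * \<rho>) * a))"
proof -
  let ?N = "complex_of_real (1 / (sqrt 2 * \<delta>))"
  let ?e = "\<lambda>p. exp (- (2 * of_real pi * \<i> * of_real (\<xi> \<bullet> p)))"
  have sub: "packet_box \<delta> a \<subseteq> unit_square" "packet_box \<delta> (- a) \<subseteq> unit_square"
    using packet_box_subset(2)[of \<delta> a] packet_box_subset(2)[of \<delta> "- a"] \<delta> a by simp_all
  have eq: "?e p * zero_extension unit_square (two_packets \<rho> \<delta> a c) p
     = indicator (packet_box \<delta> a) p * (?N * (?e p * packet \<rho> \<delta> a p))
     + indicator (packet_box \<delta> (- a)) p * (- (?N * c) * (?e p * packet \<rho> \<delta> (- a) p))" for p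
    using sub by (cases "p \<in> unit_square") (auto simp: zero_extension_def two_packets_def indicator_def algebra_simps)
  have cont: "continuous_on (packet_box \<delta> b) (\<lambda>p. k * (?e p * packet \<rho> \<delta> b p))" for k b
    by (intro continuous_intros continuous_on_packet)
  have "fourier (zero_extension unit_square (two_packets \<rho> \<delta> a c)) \<xi>
     = integral (packet_box \<delta> a) (\<lambda>p. ?N * (?e p * packet \<rho> \<delta> a p))
       + integral (packet_box \<delta> (- a)) (\<lambda>p. - (?N * c) * (?e p * packet \<rho> \<delta> (- a) p))"
    unfolding fourier_def eq
    by (simp only: Bochner_Integration.integral_add[OF lebesgue_integral_cbox(1)[OF cont] lebesgue_integral_cbox(1)[OF cont]]
        lebesgue_integral_cbox(2)[OF cont])
  also have "\<dots> = ?N * (cis (- 2 * pi * (fst \<xi> + snd \<xi> - 2 * \<rho>) * a) * (cosine_transform \<delta> (fst \<xi> - \<rho>) * cosine_transform \<delta> (snd \<xi> - \<rho>)))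
     + - (?N * c) * (cis (- 2 * pi * (fst \<xi> + snd \<xi> - 2 * \<rho>) * (- a)) * (cosine_transform \<delta> (fst \<xi> - \<rho>) * cosine_transform \<delta> (snd \<xi> - \<rho>)))"
    unfolding integral_mult_right packet_transform ..
  also have "cis (- 2 * pi * (fst \<xi> + snd \<xi> - 2 * \<rho>) * (- a)) = cis (2 * pi * (fst \<xi> + snd \<xi> - 2 * \<rho>) * a)" by simp
  finally show ?thesis by (simp only: right_diff_distrib) (simp add: mult_ac)
qed

text \<open>
  The unimodular coefficient shifts the phase so that the transform vanishes exactly on the lines that
  the turns approximate near \<open>(\<rho>, \<rho>)\<close>.
\<close>

lemma norm_fourier_two_packets:
  assumes \<eta>: "sqrt 2 / 2 \<le> \<eta>" and \<mu>: "\<mu> = 0 \<or> \<mu> = 1" and \<xi>: "(x, y) \<in> turns \<eta> \<mu>"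
    and \<delta>: "0 < \<delta>" "\<delta> \<le> 1" and a: "\<delta> < a" "a + \<delta> < 1 / 2" "2 * a = 1 / (sqrt 2 * \<eta>)" and \<rho>: "0 < \<rho>"
  shows "(cmod (fourier (zero_extension unit_square (two_packets \<rho> \<delta> a (cis (2 * pi * (4 * a * \<rho> - \<mu> / 8))))) (x, y)))\<^sup>2
    \<le> (1296 / \<rho>) / ((1 + (\<delta> * (x - \<rho>))\<^sup>2) * (1 + (\<delta> * (y - \<rho>))\<^sup>2))"
proof -
  define c where "c = cis (2 * pi * (4 * a * \<rho> - \<mu> / 8))"
  define s1 s2 where "s1 = x - \<rho>" and "s2 = y - \<rho>"
  define D1 D2 where "D1 = 1 + (\<delta> * s1)\<^sup>2" and "D2 = 1 + (\<delta> * s2)\<^sup>2"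
  have D: "0 < D1" "0 < D2" by (simp_all add: D1_def D2_def add_pos_nonneg)
  obtain k :: int where k: "\<bar>(x + y) / (sqrt 2 * \<eta>) - \<mu> / 8 - k\<bar> \<le> 2 * (1 + s1\<^sup>2 + s2\<^sup>2) / (sqrt 2 * \<rho>)"
    using turns_phase_near_integer[OF \<eta> \<mu> \<rho> \<xi>] unfolding s1_def s2_def .
  define z where "z = cis (- 2 * pi * (x + y - 2 * \<rho>) * a) - c * cis (2 * pi * (x + y - 2 * \<rho>) * a)"
  \<comment> \<open>The summand 4 a \<rho> in the phase of c removes \<rho> from the interference.
    What remains is (x + y) / (sqrt 2 * \<eta>) - \<mu> / 8, the quantity that is nearly an integer
    on the turns.\<close>
  have "c * cis (2 * pi * (x + y - 2 * \<rho>) * a) = cis (- 2 * pi * (x + y - 2 * \<rho>) * a) * cis (2 * pi * ((x + y) * (2 * a) - \<mu> / 8))"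
    unfolding c_def cis_mult by (rule arg_cong[of _ _ cis]) (simp add: algebra_simps)
  then have "z = cis (- 2 * pi * (x + y - 2 * \<rho>) * a) * (1 - cis (2 * pi * ((x + y) * (2 * a) - \<mu> / 8)))"
    unfolding z_def by (simp only: right_diff_distrib mult_1_right)
  then have "cmod z = cmod (1 - cis (2 * pi * ((x + y) * (2 * a) - \<mu> / 8)))"
    by (simp only: norm_mult norm_cis mult_1_left)
  moreover have "\<bar>((x + y) * (2 * a) - \<mu> / 8) - k\<bar> \<le> 2 * (1 + s1\<^sup>2 + s2\<^sup>2) / (sqrt 2 * \<rho>)"
    unfolding a(3) using k by simp
  then have "(cmod (1 - cis (2 * pi * ((x + y) * (2 * a) - \<mu> / 8))))\<^sup>2 \<le> 4 * pi * (2 * (1 + s1\<^sup>2 + s2\<^sup>2) / (sqrt 2 * \<rho>))"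
    by (rule norm_one_minus_cis_near_integer)
  ultimately have "(cmod z)\<^sup>2 \<le> 4 * pi * (2 * (1 + s1\<^sup>2 + s2\<^sup>2) / (sqrt 2 * \<rho>))"
    by (simp only:)
  also have "\<dots> \<le> 4 * 4 * (2 * (D1 * D2 / \<delta>\<^sup>2) / (1 * \<rho>))"
  proof (rule mult_mono)
    \<comment> \<open>This expresses the deviation through the weights of the envelope, at the price
      of \<delta>^(-2).\<close>
    have "\<delta>\<^sup>2 * (1 + s1\<^sup>2 + s2\<^sup>2) \<le> D1 * D2"
    proof -
      have "\<delta>\<^sup>2 \<le> 1" using \<delta> by (simp add: power_le_one)
      then have "\<delta>\<^sup>2 \<le> 1 + s1\<^sup>2 * (s2\<^sup>2 * \<delta> ^ 4)" by (rule order_trans) simp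
      then show ?thesis unfolding D1_def D2_def by (simp add: algebra_simps power_mult_distrib)
    qed
    then have "1 + s1\<^sup>2 + s2\<^sup>2 \<le> D1 * D2 / \<delta>\<^sup>2" using \<delta> by (simp add: pos_le_divide_eq mult.commute)
    then show "2 * (1 + s1\<^sup>2 + s2\<^sup>2) / (sqrt 2 * \<rho>) \<le> 2 * (D1 * D2 / \<delta>\<^sup>2) / (1 * \<rho>)"
      using \<rho> D by (intro frac_le mult_right_mono mult_left_mono) auto
  qed (use \<rho> pi_less_4 in \<open>auto simp: add_nonneg_nonneg\<close>)
  finally have z: "(cmod z)\<^sup>2 \<le> 32 * (D1 * D2) / (\<delta>\<^sup>2 * \<rho>)" by simp
  have q: "(cmod (cosine_transform \<delta> s1))\<^sup>2 \<le> 9 * \<delta>\<^sup>2 / D1\<^sup>2" "(cmod (cosine_transform \<delta> s2))\<^sup>2 \<le> 9 * \<delta>\<^sup>2 / D2\<^sup>2"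
    using power_mono[OF cosine_transform_bound[OF \<delta>(1), of s1], of 2] power_mono[OF cosine_transform_bound[OF \<delta>(1), of s2], of 2]
    by (simp_all add: D1_def D2_def power_divide power_mult_distrib)
  have N: "(cmod (complex_of_real (1 / (sqrt 2 * \<delta>))))\<^sup>2 = 1 / (2 * \<delta>\<^sup>2)"
    using \<delta> by (simp add: norm_divide norm_mult power_divide power_mult_distrib)
  have "(cmod (fourier (zero_extension unit_square (two_packets \<rho> \<delta> a c)) (x, y)))\<^sup>2
     = 1 / (2 * \<delta>\<^sup>2) * ((cmod (cosine_transform \<delta> s1))\<^sup>2 * (cmod (cosine_transform \<delta> s2))\<^sup>2) * (cmod z)\<^sup>2"
    unfolding fourier_two_packets[OF \<delta>(1) a(1,2)] norm_mult power_mult_distrib N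
    by (simp add: z_def s1_def s2_def)
  also have "\<dots> \<le> 1 / (2 * \<delta>\<^sup>2) * ((9 * \<delta>\<^sup>2 / D1\<^sup>2) * (9 * \<delta>\<^sup>2 / D2\<^sup>2)) * (32 * (D1 * D2) / (\<delta>\<^sup>2 * \<rho>))"
    using q z \<delta> D \<rho> by (intro mult_mono) auto
  \<comment> \<open>All powers of \<delta> cancel, and 9 * 9 * 32 / 2 = 1296.\<close>
  also have "\<dots> = 1296 / \<rho> / (D1 * D2)"
    using \<delta> D \<rho> by (simp add: field_simps power2_eq_square)
  finally show ?thesis unfolding c_def D1_def D2_def s1_def s2_def .
qed

section \<open>The constant function\<close>

text \<open>The divergence of a compactly supported field has integral 0. Integration by parts takes
  place on closed boxes inside the open square, so the support is first enclosed in a square of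
  half-width b < 1/2.\<close>

lemma constant_variation_eq_0: "variation open_unit_square (\<lambda>_. 1) = 0"
proof -
  let ?U = open_unit_square
  have "(LINT x|lebesgue_on ?U. 1 * divg h x) = 0"
    if h: "h \<in> C1_compact_support ?U" "\<forall>x\<in>?U. norm (h x) \<le> 1" for h
  proof -
    define K where "K = closure {x \<in> ?U. h x \<noteq> 0}"
    have K: "compact K" "K \<subseteq> ?U" using h(1) by (auto simp: C1_compact_support_def K_def)
    \<comment> \<open>The strict inequality on K keeps the support off the edges of the smaller
      square.\<close>
    obtain b where b: "0 < b" "b < 1 / 2" "\<And>p. p \<in> K \<Longrightarrow> max \<bar>fst p\<bar> \<bar>snd p\<bar> < b"
    proof (cases "K = {}")
      case True
      then show ?thesis using that[of "1/4"] by simp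
    next
      case False
      have "continuous_on K (\<lambda>p. max \<bar>fst p\<bar> \<bar>snd p\<bar>)" by (intro continuous_intros)
      from continuous_attains_sup[OF K(1) False this] obtain p where
        p: "p \<in> K" "\<And>q. q \<in> K \<Longrightarrow> max \<bar>fst q\<bar> \<bar>snd q\<bar> \<le> max \<bar>fst p\<bar> \<bar>snd p\<bar>" by blast
      have "max \<bar>fst p\<bar> \<bar>snd p\<bar> < 1 / 2"
        using subsetD[OF K(2) p(1)] by (cases p) (auto simp: open_unit_square_def max_def abs_if)
      then obtain b where "max \<bar>fst p\<bar> \<bar>snd p\<bar> < b" "b < 1 / 2" using dense by blast
      moreover have "0 \<le> max \<bar>fst p\<bar> \<bar>snd p\<bar>" by simp
      ultimately show ?thesis using that[of b] order.strict_trans1[OF p(2)] by (metis order.strict_trans1)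
    qed
    let ?B = "cbox (- b, - b) (b, b)"
    have B: "?B \<subseteq> ?U" using b(1,2) by (auto simp: open_unit_square_def cbox_Pair_eq)
    have h0: "h p = 0" if "p \<in> ?U" "p \<notin> K" for p
      using that closure_subset[of "{x \<in> ?U. h x \<noteq> 0}"] by (auto simp: K_def)
    have KB: "p \<in> ?B" if "p \<in> K" for p
      using b(3)[OF that] by (cases p) (simp add: abs_less_iff)
    \<comment> \<open>The values of h outside the open square are arbitrary, so the derivative is
      computed on the open set \<open>?U - ?B\<close>, where h vanishes.\<close>
    have divg0: "divg h p = 0" if p: "p \<in> ?U" "p \<notin> ?B" for p
    proof -
      have "open (?U - ?B)"
        unfolding open_unit_square_def by (intro open_Diff open_Times) auto
      moreover have "0 = h q" if "q \<in> ?U - ?B" for q using h0[of q] KB[of q] that by (metis DiffD1 DiffD2)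
      ultimately have "(h has_derivative (\<lambda>_. 0)) (at p)"
        using p has_derivative_transform_within_open[OF has_derivative_const[of 0], of "?U - ?B" p h] by blast
      from frechet_derivative_at[OF this] have "frechet_derivative h (at p) = (\<lambda>_. 0)" by simp
      then show ?thesis by (simp add: divg_def)
    qed
    have edge: "h p = 0" if "p \<in> ?B" "max \<bar>fst p\<bar> \<bar>snd p\<bar> = b" for p
      using that B b(3)[of p] h0[of p] by (metis less_irrefl subsetD)
    have bb: "- b \<le> b" using b by simp
    have bd: "y \<in> {- b..b} \<Longrightarrow> ((1::complex) = 0 \<or> h (- b, y) = 0) \<and> ((1::complex) = 0 \<or> h (b, y) = 0)"
      "y \<in> {- b..b} \<Longrightarrow> ((1::complex) = 0 \<or> h (y, - b) = 0) \<and> ((1::complex) = 0 \<or> h (y, b) = 0)" for y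
      using b(1) by (auto intro!: edge simp: cbox_Pair_eq)
    note parts = integral_divg_by_parts[OF h(1) B bb bb _ _ _ _ _ bd, of "\<lambda>_. 0" "\<lambda>_. 0"]
    have "continuous_on ?B (\<lambda>p. 1 * divg h p)" by (rule parts(1)) auto
    note i = lebesgue_integral_cbox(2)[OF this]
    have eq: "indicator ?U p *\<^sub>R (1 * divg h p) = indicator ?B p * (1 * divg h p)" for p
      using divg0[of p] B by (auto simp: indicator_def)
    have "(LINT x|lebesgue_on ?U. 1 * divg h x) = (LINT p|lebesgue. indicator ?U p *\<^sub>R (1 * divg h p))"
      using open_unit_square_lebesgue by (subst integral_restrict_space) simp_all
    also have "\<dots> = integral ?B (\<lambda>p. 1 * divg h p)" unfolding eq by (rule i)
    also have "\<dots> = - integral ?B (\<lambda>p. 0 * fst (h p) + 0 * snd (h p))"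
      by (rule parts(2)) auto
    finally show ?thesis by simp
  qed
  then show ?thesis unfolding variation_def
    by (intro antisym SUP_least) auto
qed

lemma constant_l2_norm: "l2_norm (lebesgue_on unit_square) (\<lambda>_. 1) = 1"
proof (rule l2_norm_eq_1)
  have "emeasure lebesgue unit_square = 1"
    unfolding unit_square_eq_cbox by (simp add: emeasure_lborel_cbox_eq Basis_prod_def)
  then show "(\<integral>\<^sup>+x. ennreal ((cmod 1)\<^sup>2) \<partial>lebesgue_on unit_square) = 1"
    using unit_square_lebesgue by (simp add: emeasure_restrict_space)
qed

text \<open>The factors 1 * (x - 0) and 1 * (y - 0) match the weight in
  \<open>stability_margin_le\<close> for \<delta> = 1 and \<rho> = 0.\<close>

lemma norm_fourier_constant:
  "(cmod (fourier (zero_extension unit_square (\<lambda>_. 1)) (x, y)))\<^sup>2 \<le> 4 / ((1 + (1 * (x - 0))\<^sup>2) * (1 + (1 * (y - 0))\<^sup>2))"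
proof -
  let ?S = "\<lambda>s. integral {-1/2..1/2} (\<lambda>t. cis (- 2 * pi * s * t))"
  let ?e = "\<lambda>p. exp (- (2 * of_real pi * \<i> * of_real ((x, y) \<bullet> p)))"
  have cont: "continuous_on (cbox (-1/2, -1/2) (1/2, 1/2)) ?e" by (intro continuous_intros)
  have eq: "?e p * zero_extension unit_square (\<lambda>_. 1) p = indicator (cbox (-1/2, -1/2) (1/2, 1/2)) p * ?e p" for p
    unfolding unit_square_eq_cbox by (simp add: zero_extension_def indicator_def)
  have "fourier (zero_extension unit_square (\<lambda>_. 1)) (x, y) = integral (cbox (-1/2, -1/2) (1/2, 1/2)) ?e"
    unfolding fourier_def eq by (rule lebesgue_integral_cbox(2)[OF cont])
  also have "\<dots> = ?S x * ?S y"
    using integral_fourier_cbox_times[of "-1/2" "1/2" "\<lambda>_. 1" "-1/2" "1/2" "\<lambda>_. 1" "(x, y)"] by simp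
  finally have "(cmod (fourier (zero_extension unit_square (\<lambda>_. 1)) (x, y)))\<^sup>2 = (cmod (?S x))\<^sup>2 * (cmod (?S y))\<^sup>2"
    by (simp only: norm_mult power_mult_distrib)
  also have "\<dots> \<le> (2 / (1 + x\<^sup>2)) * (2 / (1 + y\<^sup>2))"
    by (intro mult_mono interval_transform_bound) (auto simp: add_nonneg_nonneg)
  finally show ?thesis by simp
qed

section \<open>The stability margin\<close>

lemma stability_margin_le:
  assumes "f \<in> L2 (lebesgue_on unit_square)" "l2_norm (lebesgue_on unit_square) f = 1"
    and "variation open_unit_square f \<le> ennreal W"
    and \<Gamma>: "sqrt 2 / 2 \<le> \<eta>" "\<eta> \<le> 2" "\<mu> = 0 \<or> \<mu> = 1" "\<Gamma> \<in> sets borel" "\<Gamma> \<subseteq> turns \<eta> \<mu>"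
    and \<delta>: "0 < \<delta>" "\<delta> \<le> 1" and M: "0 \<le> M" and B: "0 \<le> B" "32400 * M / \<delta>\<^sup>2 \<le> B\<^sup>2"
    and F: "\<And>x y. (x, y) \<in> \<Gamma> \<Longrightarrow> (cmod (fourier (zero_extension unit_square f) (x, y)))\<^sup>2
      \<le> M / ((1 + (\<delta> * (x - \<rho>))\<^sup>2) * (1 + (\<delta> * (y - \<rho>))\<^sup>2))"
  shows "stability_margin \<Gamma> (BV_class W) \<le> ennreal B"
proof -
  have "(\<integral>\<^sup>+ \<xi>. ennreal ((cmod (fourier (zero_extension unit_square f) \<xi>))\<^sup>2) \<partial>curve_measure \<Gamma>) \<le> ennreal (32400 * M / \<delta>\<^sup>2)"
    using nn_integral_curve_measure_le[OF \<Gamma> \<delta> M F] .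
  also have "\<dots> \<le> ennreal (B\<^sup>2)" using B(2) by (rule ennreal_leI)
  finally have "l2_norm (curve_measure \<Gamma>) (fourier (zero_extension unit_square f)) \<le> ennreal B"
    by (rule l2_norm_le[OF B(1)])
  moreover have "f \<in> {f \<in> BV_class W. l2_norm (lebesgue_on unit_square) f = 1}"
    using assms(1-3) by (simp add: BV_class_def)
  ultimately show ?thesis
    unfolding stability_margin_def by (rule INF_lower2[rotated])
qed

text \<open>The constant function belongs to every class, and 32400 * 4 = 360^2.\<close>

lemma stability_margin_le_low_variation:
  assumes "sqrt 2 / 2 \<le> \<eta>" "\<eta> \<le> 2" "\<mu> = 0 \<or> \<mu> = 1" "\<Gamma> \<in> sets borel" "\<Gamma> \<subseteq> turns \<eta> \<mu>"
  shows "stability_margin \<Gamma> (BV_class W) \<le> ennreal 360"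
proof (rule stability_margin_le[OF _ constant_l2_norm _ assms, where \<delta> = 1 and M = 4 and \<rho> = 0])
  show "(\<lambda>_. 1) \<in> L2 (lebesgue_on unit_square)"
    by (simp add: L2_def constant_l2_norm)
qed (use norm_fourier_constant in \<open>auto simp: constant_variation_eq_0\<close>)

lemma stability_margin_le_high_variation:
  assumes \<epsilon>: "0 < \<epsilon>" "\<epsilon> < 1" and \<eta>: "\<eta> = (1 + \<epsilon>) * sqrt 2 / 2" and W: "100 \<le> \<epsilon> * W"
    and \<mu>: "\<mu> = 0 \<or> \<mu> = 1" and \<Gamma>: "\<Gamma> \<in> sets borel" "\<Gamma> \<subseteq> turns \<eta> \<mu>"
  shows "stability_margin \<Gamma> (BV_class W) \<le> ennreal (259200 * (\<epsilon> * W) powr (- 1 / 2))"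
proof -
  \<comment> \<open>The room between a and the edge of the square is 1/2 - a = \<epsilon> / (2 (1 +
    \<epsilon>)), which exceeds \<epsilon> / 4 because \<epsilon> < 1.\<close>
  define \<delta> where "\<delta> = \<epsilon> / 4"
  define a where "a = 1 / (2 * (1 + \<epsilon>))"
  \<comment> \<open>Then \<rho> \<delta> = W / 400, and with pi < 4 the variation is at most 0.32 W
    + 32, which is at most W as soon as W \<ge> 100.\<close>
  define \<rho> where "\<rho> = W / (100 * \<epsilon>)"
  define c where "c = cis (2 * pi * (4 * a * \<rho> - \<mu> / 8))"
  have "\<epsilon> * W > 0" using W by linarith
  then have W0: "0 < W" using \<epsilon> by (simp add: zero_less_mult_iff)
  then have "\<epsilon> * W \<le> 1 * W" using \<epsilon> by (intro mult_right_mono) auto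
  then have W100: "100 \<le> W" using W by simp
  have \<rho>: "0 < \<rho>" using W0 \<epsilon> by (simp add: \<rho>_def)
  have \<delta>: "0 < \<delta>" "\<delta> \<le> 1" using \<epsilon> by (simp_all add: \<delta>_def)
  \<comment> \<open>As \<delta> < 1/4 < a, the boxes around (a, a) and (-a, -a) are
    disjoint.\<close>
  have "1 / 4 < a" using \<epsilon> by (simp add: a_def field_simps)
  then have a1: "\<delta> < a" using \<epsilon> by (simp add: \<delta>_def)
  have "\<epsilon> * \<epsilon> < \<epsilon> * 1" using \<epsilon> by (intro mult_strict_left_mono) auto
  then have a2: "a + \<delta> < 1 / 2" using \<epsilon> by (simp add: a_def \<delta>_def field_simps)
  have "sqrt 2 * \<eta> = 1 + \<epsilon>" by (simp add: \<eta> mult.left_commute[of "sqrt 2"])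
  then have a3: "2 * a = 1 / (sqrt 2 * \<eta>)" using \<epsilon> by (simp add: a_def field_simps)
  have \<eta>1: "sqrt 2 / 2 \<le> \<eta>" using \<epsilon> by (simp add: \<eta> field_simps)
  have "(1 + \<epsilon>) * sqrt 2 \<le> 2 * 2"
    using \<epsilon> real_le_lsqrt[of 2 2] by (intro mult_mono) auto
  then have \<eta>2: "\<eta> \<le> 2" by (simp add: \<eta>)
  have c: "cmod c = 1" by (simp add: c_def)
  have l2: "l2_norm (lebesgue_on unit_square) (two_packets \<rho> \<delta> a c) = 1"
    by (rule l2_norm_two_packets[OF \<delta>(1) a1 a2 c])
  show ?thesis
  proof (rule stability_margin_le[OF _ l2 _ \<eta>1 \<eta>2 \<mu> \<Gamma> \<delta>, where M = "1296 / \<rho>" and \<rho> = \<rho>])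
    show "two_packets \<rho> \<delta> a c \<in> L2 (lebesgue_on unit_square)"
      by (simp add: L2_def two_packets_measurable l2)
    have "variation open_unit_square (two_packets \<rho> \<delta> a c) \<le> ennreal (32 * pi * \<rho> * \<delta> + 8 * pi)"
      using \<rho> by (intro variation_two_packets \<delta> a1 a2 c) simp
    also have "\<dots> \<le> ennreal W"
    proof (rule ennreal_leI)
      have \<rho>\<delta>: "\<rho> * \<delta> = W / 400" using \<epsilon> by (simp add: \<rho>_def \<delta>_def)
      have "32 * pi * \<rho> * \<delta> + 8 * pi = pi * (32 * (\<rho> * \<delta>) + 8)" by (simp add: distrib_left)
      also have "\<dots> = pi * (32 * W / 400 + 8)" unfolding \<rho>\<delta> by simp
      also have "\<dots> \<le> 4 * (32 * W / 400 + 8)"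
        using pi_less_4 W0 by (intro mult_right_mono) auto
      also have "\<dots> \<le> W" using W100 by simp
      finally show "32 * pi * \<rho> * \<delta> + 8 * pi \<le> W" .
    qed
    finally show "variation open_unit_square (two_packets \<rho> \<delta> a c) \<le> ennreal W" .
    have "((\<epsilon> * W) powr (- 1 / 2))\<^sup>2 = (\<epsilon> * W) powr (- 1)"
      using \<open>\<epsilon> * W > 0\<close> by (simp add: power2_eq_square flip: powr_add)
    also have "\<dots> = 1 / (\<epsilon> * W)" using \<open>\<epsilon> * W > 0\<close> by (simp add: powr_minus_divide)
    finally have "(259200 * (\<epsilon> * W) powr (- 1 / 2))\<^sup>2 = 67184640000 / (\<epsilon> * W)"
      by (simp add: power_mult_distrib)
    \<comment> \<open>Here \<rho> \<delta>^2 = \<epsilon> W / 1600, and 32400 * 1296 * 1600 = (180 *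
      36 * 40)^2 = 259200^2.\<close>
    moreover have "32400 * (1296 / \<rho>) / \<delta>\<^sup>2 = 67184640000 / (\<epsilon> * W)"
      using \<epsilon> W0 by (simp add: \<rho>_def \<delta>_def power2_eq_square field_simps)
    ultimately show "32400 * (1296 / \<rho>) / \<delta>\<^sup>2 \<le> (259200 * (\<epsilon> * W) powr (- 1 / 2))\<^sup>2" by simp
    show "(cmod (fourier (zero_extension unit_square (two_packets \<rho> \<delta> a c)) (x, y)))\<^sup>2
      \<le> (1296 / \<rho>) / ((1 + (\<delta> * (x - \<rho>))\<^sup>2) * (1 + (\<delta> * (y - \<rho>))\<^sup>2))" if "(x, y) \<in> \<Gamma>" for x y
      unfolding c_def using \<Gamma>(2) that
      by (intro norm_fourier_two_packets[OF \<eta>1 \<mu> _ \<delta> a1 a2 a3 \<rho>]) auto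
  qed (use \<rho> in auto)
qed

theorem theoremB:
  shows "\<exists>C::real. C > 0 \<and>
    (\<forall>(\<epsilon>::real) (\<eta>::real) (\<Gamma>::plane set) (W::real).
       0 < \<epsilon> \<and> \<epsilon> < 1 \<and> \<eta> = (1 + \<epsilon>) * sqrt 2 / 2 \<and>
       (\<Gamma> = spiral \<eta> \<or> \<Gamma> = concentric_circles \<eta>) \<and> W > 0 \<longrightarrow>
       stability_margin \<Gamma> (BV_class W)
         \<le> ennreal (C * (\<epsilon> * W) powr (- 1 / 2) * ((ln (\<epsilon> * W))\<^sup>2 + 1)))"
proof (intro exI[of _ "259200::real"] conjI allI impI)
  fix \<epsilon> \<eta> W :: real and \<Gamma> :: "plane set"
  assume asm: "0 < \<epsilon> \<and> \<epsilon> < 1 \<and> \<eta> = (1 + \<epsilon>) * sqrt 2 / 2 \<and>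
       (\<Gamma> = spiral \<eta> \<or> \<Gamma> = concentric_circles \<eta>) \<and> W > 0"
  then have \<epsilon>: "0 < \<epsilon>" "\<epsilon> < 1" and \<eta>: "\<eta> = (1 + \<epsilon>) * sqrt 2 / 2" and W: "0 < W" by auto
  have \<eta>1: "sqrt 2 / 2 \<le> \<eta>" using \<epsilon> by (simp add: \<eta> field_simps)
  have "(1 + \<epsilon>) * sqrt 2 \<le> 2 * 2"
    using \<epsilon> real_le_lsqrt[of 2 2] by (intro mult_mono) auto
  then have \<eta>2: "\<eta> \<le> 2" by (simp add: \<eta>)
  have \<eta>0: "0 \<le> \<eta>" using \<eta>1 by (rule order_trans[rotated]) simp
  obtain \<mu> :: real where \<mu>: "\<mu> = 0 \<or> \<mu> = 1" and \<Gamma>: "\<Gamma> \<in> sets borel" "\<Gamma> \<subseteq> turns \<eta> \<mu>"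
    using asm spiral_borel concentric_circles_borel spiral_subset_turns[OF \<eta>0] concentric_circles_subset_turns[OF \<eta>0]
    by blast
  define p where "p = (\<epsilon> * W) powr (- 1 / 2)"
  have p: "0 \<le> p" by (simp add: p_def)
  have "stability_margin \<Gamma> (BV_class W) \<le> ennreal (259200 * p)"
  proof (cases "100 \<le> \<epsilon> * W")
    case True
    then show ?thesis
      unfolding p_def by (rule stability_margin_le_high_variation[OF \<epsilon> \<eta> _ \<mu> \<Gamma>])
  next
    case False
    \<comment> \<open>For \<epsilon> W < 100 the factor p is at least 1/10, so the bound 360 for the
      constant function is well below 259200 p.\<close>
    have "sqrt (\<epsilon> * W) \<le> sqrt (10\<^sup>2)" using False by (intro real_sqrt_le_mono) simp
    then have s: "sqrt (\<epsilon> * W) \<le> 10" by simp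
    have "p = 1 / sqrt (\<epsilon> * W)"
      using \<epsilon> W by (simp add: p_def powr_minus_divide powr_half_sqrt)
    also have "\<dots> \<ge> 1 / 10" using s \<epsilon> W by (intro frac_le) auto
    finally have "360 \<le> 259200 * p" by simp
    then show ?thesis
      using stability_margin_le_low_variation[OF \<eta>1 \<eta>2 \<mu> \<Gamma>] ennreal_leI order_trans by blast
  qed
  \<comment> \<open>The logarithmic factor is at least 1.\<close>
  also have "\<dots> \<le> ennreal (259200 * p * ((ln (\<epsilon> * W))\<^sup>2 + 1))"
    using p by (intro ennreal_leI) (simp add: distrib_left)
  finally show "stability_margin \<Gamma> (BV_class W) \<le> ennreal (259200 * (\<epsilon> * W) powr (- 1 / 2) * ((ln (\<epsilon> * W))\<^sup>2 + 1))"
    by (simp add: p_def)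
qed simp

end
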